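(* Assuming the Exponential Time Hypothesis, there is no algorithm solving \textsc{Minimax Approval Voting} in time $2^{o(d\log d)}\cdot\mathrm{poly}(n,m)$.
   Context: \textsc{Minimax Approval Voting}: given a multiset $S=\{s_1,\dots,s_n\}$ of strings in $\{0,1\}^m$ and integers $k,d$, decide whether there exists $s\in\{0,1\}^m$ with exactly $k$ ones such that the Hamming distance between $s$ and $s_i$ is at most $d$ for every $i=1,\dots,n$. The Exponential Time Hypothesis (ETH) states that there is a constant $c>0$ such that \textsc{3-SAT} on $n$ variables cannot be solved in time $2^{cn}\cdot\mathrm{poly}$ of the input size. *)

theory Defs
  imports Complex_Main "HOL-Library.Multiset" "HOL-Library.Landau_Symbols"
begin

text \<open>
  Algorithms are programs of a unit-cost random access machine with finitely many registers per
  program and an unbounded memory. Arithmetic is restricted to addition and truncated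
  subtraction: multiplication at unit cost would make the machine stronger than Turing machines
  under polynomial time, whereas this instruction set is polynomially equivalent to them. Both the
  Exponential Time Hypothesis and running times of the form \<open>2\<^bsup>o(d log d)\<^esup> \<cdot> poly\<close> are invariant
  under polynomial changes of the machine model.
\<close>

type_synonym reg = nat

datatype instr =
    Const reg nat
  | Add reg reg reg
  | Sub reg reg reg
  | Load reg reg       \<comment> \<open>\<open>Load r a\<close>: register \<open>r\<close> receives the memory cell addressed by register \<open>a\<close>\<close>
  | Store reg reg      \<comment> \<open>\<open>Store a r\<close>: the memory cell addressed by register \<open>a\<close> receives register \<open>r\<close>\<close>
  | Jump nat
  | JumpZero reg nat

type_synonym program = "instr list"

text \<open>A configuration consists of the program counter, the registers and the memory.\<close>

type_synonym config = "nat \<times> (reg \<Rightarrow> nat) \<times> (nat \<Rightarrow> nat)"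

fun exec :: "instr \<Rightarrow> config \<Rightarrow> config" where
  "exec (Const r c) (pc, R, M) = (Suc pc, R(r := c), M)"
| "exec (Add r a b) (pc, R, M) = (Suc pc, R(r := R a + R b), M)"
| "exec (Sub r a b) (pc, R, M) = (Suc pc, R(r := R a - R b), M)"
| "exec (Load r a) (pc, R, M) = (Suc pc, R(r := M (R a)), M)"
| "exec (Store a r) (pc, R, M) = (Suc pc, R, M(R a := R r))"
| "exec (Jump l) (pc, R, M) = (l, R, M)"
| "exec (JumpZero r l) (pc, R, M) = (if R r = 0 then l else Suc pc, R, M)"

definition halted :: "program \<Rightarrow> config \<Rightarrow> bool" where
  "halted P s \<longleftrightarrow> length P \<le> fst s"

definition step :: "program \<Rightarrow> config \<Rightarrow> config" where
  "step P s = (if halted P s then s else exec (P ! fst s) s)"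

definition init :: "nat list \<Rightarrow> config" where
  "init xs = (0, (\<lambda>_. 0), (\<lambda>i. if i < length xs then xs ! i else 0))"

text \<open>The answer of a halted machine is \<open>yes\<close> iff register 0 is nonzero.\<close>

definition answers_within :: "program \<Rightarrow> nat list \<Rightarrow> real \<Rightarrow> bool \<Rightarrow> bool" where
  "answers_within P xs T b \<longleftrightarrow>
     (\<exists>t. real t \<le> T \<and>
        (case (step P ^^ t) (init xs) of (pc, R, M) \<Rightarrow>
           halted P (pc, R, M) \<and> (R 0 \<noteq> 0 \<longleftrightarrow> b)))"

definition solves_in_time ::
  "program \<Rightarrow> 'i set \<Rightarrow> ('i \<Rightarrow> bool) \<Rightarrow> ('i \<Rightarrow> nat list) \<Rightarrow> ('i \<Rightarrow> real) \<Rightarrow> bool" where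
  "solves_in_time P instances yes enc T \<longleftrightarrow>
     (\<forall>I\<in>instances. answers_within P (enc I) (T I) (yes I))"


section \<open>3-SAT and the Exponential Time Hypothesis\<close>

text \<open>
  A literal \<open>(v, b)\<close> is true iff the variable \<open>v\<close> has the value \<open>b\<close>. An instance \<open>(n, cs)\<close> is a
  CNF formula with variables \<open>0, \<dots>, n - 1\<close> and at most three literals per clause.
\<close>

type_synonym literal = "nat \<times> bool"
type_synonym clause = "literal list"
type_synonym sat_instance = "nat \<times> clause list"

definition three_sat_instances :: "sat_instance set" where
  "three_sat_instances =
     {(n, cs). \<forall>c\<in>set cs. length c \<le> 3 \<and> (\<forall>(v, b)\<in>set c. v < n)}"

fun satisfiable :: "sat_instance \<Rightarrow> bool" where
  "satisfiable (n, cs) \<longleftrightarrow> (\<exists>\<alpha> :: nat \<Rightarrow> bool. \<forall>c\<in>set cs. \<exists>(v, b)\<in>set c. \<alpha> v = b)"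

fun encode_clause :: "clause \<Rightarrow> nat list" where
  "encode_clause c = length c # map (\<lambda>(v, b). 2 * v + of_bool b) c"

fun encode_sat :: "sat_instance \<Rightarrow> nat list" where
  "encode_sat (n, cs) = n # length cs # concat (map encode_clause cs)"

text \<open>
  Polynomial factors are bounds \<open>C \<cdot> size\<^sup>e\<close>, where the input size is the length of the encoding
  (which is at least 2).
\<close>

definition ETH :: bool where
  "ETH \<longleftrightarrow>
     (\<exists>c::real. c > 0 \<and>
        \<not> (\<exists>(P :: program) (C :: real) (e :: nat).
              solves_in_time P three_sat_instances satisfiable encode_sat
                (\<lambda>(n, cs). 2 powr (c * real n) * (C * real (length (encode_sat (n, cs))) ^ e))))"


section \<open>Minimax Approval Voting\<close>

definition hamming_dist :: "bool list \<Rightarrow> bool list \<Rightarrow> nat" where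
  "hamming_dist s t = card {i. i < length s \<and> s ! i \<noteq> t ! i}"

definition minimax_approval_voting :: "nat \<Rightarrow> bool list multiset \<Rightarrow> nat \<Rightarrow> nat \<Rightarrow> bool" where
  "minimax_approval_voting m S k d \<longleftrightarrow>
     (\<exists>s. length s = m \<and> count_list s True = k \<and> (\<forall>x\<in>#S. hamming_dist s x \<le> d))"

text \<open>
  As an input, the multiset of strings is given by a list enumerating it, in arbitrary order; an
  instance is \<open>(m, ss, k, d)\<close>.
\<close>

type_synonym mav_instance = "nat \<times> bool list list \<times> nat \<times> nat"

definition mav_instances :: "mav_instance set" where
  "mav_instances = {(m, ss, k, d). \<forall>s\<in>set ss. length s = m}"

fun mav_yes :: "mav_instance \<Rightarrow> bool" where
  "mav_yes (m, ss, k, d) \<longleftrightarrow> minimax_approval_voting m (mset ss) k d"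

fun encode_mav :: "mav_instance \<Rightarrow> nat list" where
  "encode_mav (m, ss, k, d) = [length ss, m, k, d] @ map of_bool (concat ss)"

end

theory Submission
  imports Defs
begin

text \<open>
  3-SAT reduces directly to Minimax Approval Voting with \<open>d log d = O(n)\<close>; no sparsification is
  needed because a single string expresses a whole clause. Split the \<open>n\<close> variables into \<open>K\<close> groups of
  size \<open>b\<close>, where \<open>b\<close> is about \<open>(log n) / 2\<close>, and give every group a row of \<open>W = 3 \<cdot> 2\<^sup>b\<close> cells, the first
  \<open>2\<^sup>b\<close> of which stand for the assignments of the group. If all strings have exactly \<open>W\<close> ones and \<open>s\<close>
  has exactly \<open>K\<close> ones, then a distance of at most \<open>d = K + W - 2\<close> means that the ones of \<open>s\<close> meet those
  of the string. A string for each row forces \<open>s\<close> to select exactly one cell per row and nothing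
  else; a string for each clause, with ones at the cells that satisfy one of its literals and
  padded to weight \<open>W\<close> outside of the rows, forces the clause to be true. As \<open>K \<le> n / b + 1\<close>,
  \<open>2\<^sup>b = O(\<surd>n)\<close> and \<open>log d = O(b)\<close>, time \<open>2\<^bsup>o(d log d)\<^esup> \<cdot> poly\<close> becomes \<open>2\<^bsup>o(n)\<^esup> \<cdot> poly\<close>.

  A machine program that writes the reduced instance behind the input, followed by the given
  program with its memory shifted there, then contradicts the hypothesis.
\<close>


section \<open>Structured programs\<close>

type_synonym regs = "nat \<Rightarrow> nat"
type_synonym mem = "nat \<Rightarrow> nat"

fun straight :: "instr \<Rightarrow> bool" where
  "straight (Jump l) = False"
| "straight (JumpZero r l) = False"
| "straight _ = True"

text \<open>The program counter 0 passed to \<open>exec\<close> is a dummy: straight instructions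
  merely increment it, so their effect on registers and memory does not depend on it.\<close>

fun exec_block :: "instr list \<Rightarrow> regs \<times> mem \<Rightarrow> regs \<times> mem" where
  "exec_block [] s = s"
| "exec_block (i # is) s = exec_block is (snd (exec i (0, s)))"

datatype com = Block "instr list" | Seq com com (infixr ";;" 60) | IfNZ reg com | While reg com

text \<open>The number is the exact step count of the compiled code: a conditional jump costs 1, and
  every completed loop round costs 2 more than its body, for the test and the jump back.\<close>

inductive runs :: "com \<Rightarrow> regs \<times> mem \<Rightarrow> nat \<Rightarrow> regs \<times> mem \<Rightarrow> bool" where
  runs_Block: "list_all straight is \<Longrightarrow> runs (Block is) s (length is) (exec_block is s)"
| runs_Seq: "runs c s t s' \<Longrightarrow> runs c' s' t' s'' \<Longrightarrow> runs (Seq c c') s (t + t') s''"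
| runs_IfNZ_False: "fst s r = 0 \<Longrightarrow> runs (IfNZ r c) s 1 s"
| runs_IfNZ_True: "fst s r \<noteq> 0 \<Longrightarrow> runs c s t s' \<Longrightarrow> runs (IfNZ r c) s (t + 1) s'"
| runs_While_False: "fst s r = 0 \<Longrightarrow> runs (While r c) s 1 s"
| runs_While_True: "fst s r \<noteq> 0 \<Longrightarrow> runs c s t s' \<Longrightarrow> runs (While r c) s' t' s'' \<Longrightarrow>
    runs (While r c) s (t' + (t + 2)) s''"

text \<open>Jump targets are absolute, so the address \<open>l\<close> of the first instruction is a
  parameter. A loop exit skips the test, the body and the jump back, hence
  \<open>l + length p + 2\<close>.\<close>

fun compile :: "nat \<Rightarrow> com \<Rightarrow> program" where
  "compile l (Block is) = is"
| "compile l (Seq c c') = (let p = compile l c in p @ compile (l + length p) c')"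
| "compile l (IfNZ r c) = (let p = compile (l + 1) c in JumpZero r (l + length p + 1) # p)"
| "compile l (While r c) =
     (let p = compile (l + 1) c in JumpZero r (l + length p + 2) # p @ [Jump l])"

lemma step_nth:
  "step (pre @ i # post) (length pre, s) = exec i (length pre, s)"
  by (simp add: step_def halted_def)

lemma step_exec_block:
  "list_all straight is \<Longrightarrow>
   (step (pre @ is @ post) ^^ length is) (length pre, s) = (length pre + length is, exec_block is s)"
proof (induction "is" arbitrary: pre s)
  case Nil
  then show ?case by simp
next
  case (Cons i "is")
  obtain R M where s: "s = (R, M)" by (cases s)
  have "exec i (length pre, s) = (Suc (length pre), snd (exec i (0, s)))"
    using Cons.prems by (cases i) (auto simp: s)
  with Cons.IH[of "pre @ [i]" "snd (exec i (0, s))"] Cons.prems show ?case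
    by (simp add: funpow_Suc_right step_nth del: funpow.simps)
qed

lemma funpow_add_apply: "(f ^^ t) x = y \<Longrightarrow> (f ^^ (t' + t)) x = (f ^^ t') y"
  by (simp add: funpow_add)

text \<open>The code is placed between arbitrary \<open>pre\<close> and \<open>post\<close> because
  in the induction each subprogram is surrounded by the code of the enclosing one.\<close>

lemma runs_compile:
  "runs c s t s' \<Longrightarrow>
   (step (pre @ compile (length pre) c @ post) ^^ t) (length pre, s) =
     (length pre + length (compile (length pre) c), s')"
proof (induction arbitrary: pre post rule: runs.induct)
  case (runs_Block "is" s)
  then show ?case by (simp add: step_exec_block)
next
  case (runs_Seq c s t s' c' t' s'')
  let ?p = "compile (length pre) c"
  from funpow_add_apply[OF runs_Seq.IH(1)[of pre "compile (length pre + length ?p) c' @ post"], of t']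
    runs_Seq.IH(2)[of "pre @ ?p" post]
  show ?case by (simp add: Let_def add.commute[of t] add.assoc)
next
  case (runs_IfNZ_False s r c)
  then show ?case by (cases s) (simp add: Let_def step_nth)
next
  case (runs_IfNZ_True s r c t s')
  let ?i = "JumpZero r (length pre + length (compile (Suc (length pre)) c) + 1)"
  have "(step (pre @ compile (length pre) (IfNZ r c) @ post) ^^ 1) (length pre, s) = (Suc (length pre), s)"
    using runs_IfNZ_True.hyps by (cases s) (simp add: Let_def step_nth)
  from funpow_add_apply[OF this, of t] runs_IfNZ_True.IH[of "pre @ [?i]" post]
  show ?case by (simp add: Let_def)
next
  case (runs_While_False s r c)
  then show ?case by (cases s) (simp add: Let_def step_nth)
next
  case (runs_While_True s r c t s' t' s'')
  let ?p = "compile (Suc (length pre)) c"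
  let ?i = "JumpZero r (length pre + length ?p + 2)"
  let ?P = "pre @ compile (length pre) (While r c) @ post"
  have 1: "(step ?P ^^ 1) (length pre, s) = (Suc (length pre), s)"
    using runs_While_True.hyps by (cases s) (simp add: Let_def step_nth)
  have 2: "(step ?P ^^ t) (Suc (length pre), s) = (Suc (length pre) + length ?p, s')"
    using runs_While_True.IH(1)[of "pre @ [?i]" "Jump (length pre) # post"] by (simp add: Let_def)
  have 3: "(step ?P ^^ 1) (Suc (length pre) + length ?p, s') = (length pre, s')"
    using step_nth[of "pre @ ?i # ?p" "Jump (length pre)" post s']
    by (cases s') (simp add: Let_def)
  have "(step ?P ^^ (1 + (t + 1))) (length pre, s) = (length pre, s')"
    by (simp only: funpow_add_apply[OF funpow_add_apply[OF 1, of t, unfolded 2]] 3)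
  from funpow_add_apply[OF this, of t'] runs_While_True.IH(2)[of pre post]
  show ?case by (simp add: Let_def)
qed

section \<open>A Hoare calculus with time bounds\<close>

fun instr_writes :: "instr \<Rightarrow> reg set" where
  "instr_writes (Const r c) = {r}"
| "instr_writes (Add r a b) = {r}"
| "instr_writes (Sub r a b) = {r}"
| "instr_writes (Load r a) = {r}"
| "instr_writes _ = {}"

fun writes :: "com \<Rightarrow> reg set" where
  "writes (Block is) = (\<Union>i\<in>set is. instr_writes i)"
| "writes (Seq c c') = writes c \<union> writes c'"
| "writes (IfNZ r c) = writes c"
| "writes (While r c) = writes c"

lemma exec_block_unchanged:
  "r \<notin> (\<Union>i\<in>set is. instr_writes i) \<Longrightarrow> fst (exec_block is s) r = fst s r"
proof (induction "is" arbitrary: s)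
  case (Cons i "is")
  then have "fst (snd (exec i (0, s))) r = fst s r"
    by (cases i; cases s) auto
  with Cons show ?case by simp
qed simp

text \<open>The frame rule: assertions need only mention registers that change, and all other values
  are recovered from the set \<open>writes c\<close>.\<close>

lemma runs_unchanged: "runs c s t s' \<Longrightarrow> r \<notin> writes c \<Longrightarrow> fst s' r = fst s r"
  by (induction rule: runs.induct) (simp_all add: exec_block_unchanged)

text \<open>A total correctness triple for one fixed start state. The time is only bounded from
  above, so that estimates can be weakened along the way.\<close>

definition achieves :: "com \<Rightarrow> regs \<times> mem \<Rightarrow> nat \<Rightarrow> (regs \<Rightarrow> mem \<Rightarrow> bool) \<Rightarrow> bool" where
  "achieves c s T Q \<longleftrightarrow> (\<exists>t R M. t \<le> T \<and> runs c s t (R, M) \<and> Q R M)"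

lemma achieves_mono:
  assumes "achieves c s T Q" "T \<le> T'" "\<And>R M. Q R M \<Longrightarrow> (\<forall>r. r \<notin> writes c \<longrightarrow> R r = fst s r) \<Longrightarrow> Q' R M"
  shows "achieves c s T' Q'"
proof -
  from assms(1) obtain t R M where t: "t \<le> T" "runs c s t (R, M)" "Q R M"
    by (auto simp: achieves_def)
  then have "Q' R M" using assms(3) runs_unchanged[OF t(2)] by simp
  with t assms(2) show ?thesis unfolding achieves_def by (meson le_trans)
qed

lemma achieves_Block:
  assumes "list_all straight is" "length is \<le> T" "case_prod Q (exec_block is s)"
  shows "achieves (Block is) s T Q"
  unfolding achieves_def using runs_Block[OF assms(1), of s] assms(2,3)
  by (cases "exec_block is s") auto

lemma achieves_Seq:
  assumes "achieves c s T Q" "T + T' \<le> T''"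
    "\<And>R M. Q R M \<Longrightarrow> (\<forall>r. r \<notin> writes c \<longrightarrow> R r = fst s r) \<Longrightarrow> achieves c' (R, M) T' Q'"
  shows "achieves (Seq c c') s T'' Q'"
proof -
  from assms(1) order_refl have "achieves c s T (\<lambda>R M. achieves c' (R, M) T' Q')"
    by (rule achieves_mono) (use assms(3) in blast)
  with assms(2) show ?thesis
    unfolding achieves_def by (meson add_mono order_trans runs_Seq)
qed

lemma achieves_IfNZ:
  assumes "fst s r = 0 \<Longrightarrow> case_prod Q s" "fst s r \<noteq> 0 \<Longrightarrow> achieves c s T Q" "T + 1 \<le> T'"
  shows "achieves (IfNZ r c) s T' Q"
proof (cases "fst s r = 0")
  case True
  obtain R M where s: "s = (R, M)" by (cases s)
  have "1 \<le> T'" "Q R M" using assms(1,3) True s by auto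
  with runs_IfNZ_False[OF True, of c] show ?thesis
    unfolding achieves_def s by blast
next
  case False
  with assms(2) obtain t R M where "t \<le> T" "runs c s t (R, M)" "Q R M"
    by (auto simp: achieves_def)
  with runs_IfNZ_True[OF False] assms(3) show ?thesis
    unfolding achieves_def by (metis add_le_mono1 order_trans)
qed

text \<open>The index of \<open>I\<close> is the number of rounds still to come. It is the
  termination measure and yields the time: \<open>T + 2\<close> per round and 1 for the final test.
  The body may rely on unwritten registers having their values from before the loop.\<close>

lemma achieves_While:
  assumes "I k (fst s) (snd s)" "(T + 2) * k + 1 \<le> T'"
    and body: "\<And>k R M. I (Suc k) R M \<Longrightarrow> (\<forall>x. x \<notin> writes c \<longrightarrow> R x = fst s x) \<Longrightarrow>
      R r \<noteq> 0 \<and> achieves c (R, M) T (I k)"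
    and final: "\<And>R M. I 0 R M \<Longrightarrow> R r = 0"
  shows "achieves (While r c) s T' (I 0)"
proof -
  let ?J = "\<lambda>s'. \<forall>x. x \<notin> writes c \<longrightarrow> fst s' x = fst s x"
  have "\<exists>t R' M'. t \<le> (T + 2) * k + 1 \<and> runs (While r c) s' t (R', M') \<and> I 0 R' M'"
    if "I k (fst s') (snd s')" "?J s'" for k s'
    using that
  proof (induction k arbitrary: s')
    case 0
    then have "fst s' r = 0" using final by blast
    from runs_While_False[OF this, of c] 0 show ?case by (cases s') fastforce
  next
    case (Suc k)
    obtain R M where s': "s' = (R, M)" by (cases s')
    from Suc.prems body[of k R M] s' have nz: "fst s' r \<noteq> 0" and "achieves c s' T (I k)"
      by auto
    then obtain t R1 M1 where 1: "t \<le> T" "runs c s' t (R1, M1)" "I k R1 M1"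
      by (auto simp: achieves_def)
    have "?J (R1, M1)" using runs_unchanged[OF 1(2)] Suc.prems(2) by auto
    with Suc.IH[of "(R1, M1)"] 1(3) obtain t' R2 M2 where
      2: "t' \<le> (T + 2) * k + 1" "runs (While r c) (R1, M1) t' (R2, M2)" "I 0 R2 M2"
      by auto
    have "t' + (t + 2) \<le> (T + 2) * Suc k + 1" using 1(1) 2(1) by simp
    with runs_While_True[OF nz 1(2) 2(2)] 2(3) show ?case by blast
  qed
  from this[of k s] assms(1,2) show ?thesis
    unfolding achieves_def by (meson order_trans)
qed

section \<open>Relocated programs\<close>

text \<open>Registers 1 to 30 are kept free for the code that prepares the input; register 0 keeps its
  place because it carries the answer. The memory of the simulated program starts at the address
  in register 2. Every instruction becomes exactly two, so that jump targets are merely doubled.\<close>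

definition sim_reg :: "reg \<Rightarrow> reg" where
  "sim_reg r = (if r = 0 then 0 else r + 30)"

text \<open>Register 1 receives the shifted address of a memory access. For all other instructions
  the filler only overwrites this scratch register.\<close>

fun sim_pre :: "instr \<Rightarrow> instr" where
  "sim_pre (Load r a) = Add 1 (sim_reg a) 2"
| "sim_pre (Store a r) = Add 1 (sim_reg a) 2"
| "sim_pre _ = Const 1 0"

fun sim_main :: "nat \<Rightarrow> instr \<Rightarrow> instr" where
  "sim_main l (Const r c) = Const (sim_reg r) c"
| "sim_main l (Add r a b) = Add (sim_reg r) (sim_reg a) (sim_reg b)"
| "sim_main l (Sub r a b) = Sub (sim_reg r) (sim_reg a) (sim_reg b)"
| "sim_main l (Load r a) = Load (sim_reg r) 1"
| "sim_main l (Store a r) = Store 1 (sim_reg r)"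
| "sim_main l (Jump j) = Jump (l + 2 * j)"
| "sim_main l (JumpZero r j) = JumpZero (sim_reg r) (l + 2 * j)"

definition relocate :: "nat \<Rightarrow> program \<Rightarrow> program" where
  "relocate l P = concat (map (\<lambda>i. [sim_pre i, sim_main l i]) P)"

lemma length_relocate: "length (relocate l P) = 2 * length P"
  unfolding relocate_def by (induction P) auto

lemma nth_relocate:
  "i < length P \<Longrightarrow> relocate l P ! (2 * i) = sim_pre (P ! i) \<and>
    relocate l P ! Suc (2 * i) = sim_main l (P ! i)"
  unfolding relocate_def
proof (induction P arbitrary: i)
  case (Cons a P)
  then show ?case by (cases i) auto
qed simp

text \<open>Memory below \<open>base\<close> is left unconstrained: the original input remains
  there, out of reach of the simulated program.\<close>

fun sim_rel :: "nat \<Rightarrow> nat \<Rightarrow> config \<Rightarrow> config \<Rightarrow> bool" where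
  "sim_rel l base (pc, R, M) (pc', R', M') \<longleftrightarrow>
     pc' = l + 2 * pc \<and> (\<forall>r. R' (sim_reg r) = R r) \<and> R' 2 = base \<and> (\<forall>a. M' (base + a) = M a)"

lemma sim_reg_simps [simp]:
  "sim_reg r = sim_reg r' \<longleftrightarrow> r = r'" "sim_reg r \<noteq> Suc 0" "sim_reg r \<noteq> 2" "2 \<noteq> sim_reg r" "Suc 0 \<noteq> sim_reg r"
  by (auto simp: sim_reg_def)

lemma funpow_two: "(f ^^ 2) x = f (f x)"
  by (simp add: numeral_2_eq_2)

text \<open>If the simulated program has halted, \<open>length pre + 2 * pc\<close> lies behind the
  relocated code as well, and both machines stand still. Otherwise the two instructions of the pair
  are executed in turn.\<close>

lemma step_relocate:
  assumes "sim_rel (length pre) base s s'"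
  shows "sim_rel (length pre) base (step P s)
    ((step (pre @ relocate (length pre) P) ^^ 2) s')"
proof -
  obtain pc R M where s: "s = (pc, R, M)" by (cases s)
  obtain pc' R' M' where s': "s' = (pc', R', M')" by (cases s')
  let ?l = "length pre" let ?P = "pre @ relocate ?l P"
  from assms have pc': "pc' = ?l + 2 * pc" by (simp add: s s')
  show ?thesis
  proof (cases "pc < length P")
    case False
    with assms pc' show ?thesis
      by (simp add: s s' step_def halted_def length_relocate funpow_two)
  next
    case True
    have 1: "step ?P (pc', R1, M1) = exec (sim_pre (P ! pc)) (pc', R1, M1)" for R1 M1
      using True nth_relocate[OF True]
      by (simp add: step_def halted_def length_relocate pc' nth_append)
    have 2: "step ?P (Suc pc', R1, M1) = exec (sim_main ?l (P ! pc)) (Suc pc', R1, M1)" for R1 M1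
      using True nth_relocate[OF True]
      by (simp add: step_def halted_def length_relocate pc' nth_append)
    have 3: "step P s = exec (P ! pc) s" using True by (simp add: s step_def halted_def)
    have 4: "(step ?P ^^ 2) s' = exec (sim_main ?l (P ! pc)) (exec (sim_pre (P ! pc)) s')"
      by (cases "P ! pc") (simp_all add: funpow_two s' 1 2)
    show ?thesis
      using assms unfolding 3 4 unfolding s s'
      by (cases "P ! pc") (auto simp: add.commute)
  qed
qed

lemma steps_relocate:
  assumes "sim_rel (length pre) base s s'"
  shows "sim_rel (length pre) base ((step P ^^ t) s)
    ((step (pre @ relocate (length pre) P) ^^ (2 * t)) s')"
proof (induction t)
  case (Suc t)
  from step_relocate[OF Suc, where P = P] show ?case
    by (simp add: funpow_two)
qed (simp add: assms)

text \<open>Control falls through from the code of \<open>c\<close> to the relocated program. At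
  that point the simulated registers are zero and the memory from \<open>R 2\<close> on holds
  \<open>ys\<close> followed by zeros, which is the initial configuration of \<open>P\<close>. The
  factor 2 is the cost of the simulation.\<close>

lemma answers_within_relocate:
  assumes build: "achieves c (snd (init xs)) T (\<lambda>R M. (\<forall>r. R (sim_reg r) = 0) \<and>
      (\<forall>i. M (R 2 + i) = (if i < length ys then ys ! i else 0)))"
    and P: "answers_within P ys T' b"
  shows "answers_within (compile 0 c @ relocate (length (compile 0 c)) P) xs (real T + 2 * T') b"
proof -
  let ?p = "compile 0 c" let ?P = "?p @ relocate (length ?p) P"
  from build obtain t R M where 1: "t \<le> T" "runs c (snd (init xs)) t (R, M)"
    "\<forall>r. R (sim_reg r) = 0" "\<forall>i. M (R 2 + i) = (if i < length ys then ys ! i else 0)"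
    by (auto simp: achieves_def)
  from P obtain t' where 2: "real t' \<le> T'" and 3: "case (step P ^^ t') (init ys) of (pc, R, M) \<Rightarrow>
           halted P (pc, R, M) \<and> (R 0 \<noteq> 0 \<longleftrightarrow> b)"
    by (auto simp: answers_within_def)
  have "(step ?P ^^ t) (init xs) = (length ?p, R, M)"
    using runs_compile[OF 1(2), of "[]" "relocate (length ?p) P"] by (simp add: init_def)
  from funpow_add_apply[OF this, of "2 * t'"]
  have 4: "(step ?P ^^ (2 * t' + t)) (init xs) = (step ?P ^^ (2 * t')) (length ?p, R, M)" .
  have "sim_rel (length ?p) (R 2) (init ys) (length ?p, R, M)"
    using 1(3,4) by (simp add: init_def)
  from steps_relocate[OF this, where P = P and t = t']
  have 5: "sim_rel (length ?p) (R 2) ((step P ^^ t') (init ys)) ((step ?P ^^ (2 * t' + t)) (init xs))"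
    by (simp only: 4)
  obtain pc R1 M1 where 6: "(step P ^^ t') (init ys) = (pc, R1, M1)"
    by (cases "(step P ^^ t') (init ys)")
  obtain pc' R2 M2 where 7: "(step ?P ^^ (2 * t' + t)) (init xs) = (pc', R2, M2)"
    by (cases "(step ?P ^^ (2 * t' + t)) (init xs)")
  from 5 6 7 have pc': "pc' = length ?p + 2 * pc" and "R2 (sim_reg 0) = R1 0" by auto
  then have R2: "R2 0 = R1 0" by (simp add: sim_reg_def)
  have "real (2 * t' + t) \<le> real T + 2 * T'" using 1(1) 2 by simp
  moreover have "halted ?P (pc', R2, M2)" "R2 0 \<noteq> 0 \<longleftrightarrow> b"
    using 3 6 R2 by (auto simp: halted_def length_relocate pc')
  ultimately show ?thesis
    unfolding answers_within_def
    by (intro exI[of _ "2 * t' + t"]) (simp only: 7 prod.case)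
qed

section \<open>The reduction\<close>

text \<open>Cell \<open>g * W + a\<close> with \<open>a < 2 ^ b\<close> stands for giving the variables \<open>g * b, \<dots>, g * b + b - 1\<close> the bits
  of \<open>a\<close>. Cells with \<open>a \<ge> 2 ^ b\<close> satisfy no literal; they only give rows the weight \<open>W\<close> of the
  padded clauses.\<close>

definition lit_cells :: "nat \<Rightarrow> nat \<Rightarrow> literal \<Rightarrow> nat set" where
  "lit_cells b W l =
     {(fst l div b) * W + a |a. a < 2 ^ b \<and> odd (a div 2 ^ (fst l mod b)) = snd l}"

definition clause_cells :: "nat \<Rightarrow> nat \<Rightarrow> clause \<Rightarrow> nat set" where
  "clause_cells b W c = (\<Union>l\<in>set c. lit_cells b W l)"

definition padded_cells :: "nat \<Rightarrow> nat \<Rightarrow> nat \<Rightarrow> clause \<Rightarrow> nat set" where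
  "padded_cells b W K c =
     clause_cells b W c \<union> {K * W..<K * W + (W - card (clause_cells b W c))}"

definition row_cells :: "nat \<Rightarrow> nat \<Rightarrow> nat set" where
  "row_cells W g = {g * W..<g * W + W}"

definition bits :: "nat \<Rightarrow> nat set \<Rightarrow> bool list" where
  "bits m A = map (\<lambda>p. p \<in> A) [0..<m]"

lemma length_bits [simp]: "length (bits m A) = m" and nth_bits [simp]: "i < m \<Longrightarrow> bits m A ! i = (i \<in> A)"
  by (auto simp: bits_def)

lemma count_list_True: "count_list s True = card {i. i < length s \<and> s ! i}"
proof -
  have "count_list s True = length (filter id s)"
    by (induction s) auto
  then show ?thesis by (simp add: length_filter_conv_card)
qed

text \<open>The distance equals \<open>K + W - 2 * card (?S \<inter> A)\<close>, so a threshold of 2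
  below the maximum \<open>K + W\<close> demands exactly one common one or more. The condition
  \<open>2 \<le> W\<close> keeps the truncated subtraction exact.\<close>

lemma hamming_dist_bits_le_iff:
  assumes "length s = m" "A \<subseteq> {..<m}" "card A = W" "count_list s True = K" "2 \<le> W"
  shows "hamming_dist s (bits m A) \<le> K + W - 2 \<longleftrightarrow> {i. i < m \<and> s ! i} \<inter> A \<noteq> {}"
proof -
  let ?S = "{i. i < m \<and> s ! i}"
  have fin: "finite ?S" "finite A" using assms(2) finite_subset by auto
  have S: "card ?S = K" using assms count_list_True by metis
  have "{i. i < length s \<and> s ! i \<noteq> bits m A ! i} = (?S - A) \<union> (A - ?S)"
    using assms(1,2) by auto
  then have "hamming_dist s (bits m A) = card (?S - A) + card (A - ?S)"
    unfolding hamming_dist_def using fin by (simp add: card_Un_disjoint disjoint_iff)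
  moreover have "card (?S - A) + card (?S \<inter> A) = K" "card (A - ?S) + card (?S \<inter> A) = W"
    using card_Int_Diff[OF fin(1), of A] card_Int_Diff[OF fin(2), of ?S] S assms(3)
    by (simp_all add: Int_commute)
  moreover have "card (?S \<inter> A) = 0 \<longleftrightarrow> ?S \<inter> A = {}" using fin by simp
  ultimately show ?thesis using assms(5) by linarith
qed

lemma finite_lit_cells: "finite (lit_cells b W l)" and card_lit_cells: "card (lit_cells b W l) \<le> 2 ^ b"
proof -
  have *: "lit_cells b W l \<subseteq> (\<lambda>a. (fst l div b) * W + a) ` {..<2 ^ b}"
    unfolding lit_cells_def by auto
  then show "finite (lit_cells b W l)" using finite_subset by blast
  from * show "card (lit_cells b W l) \<le> 2 ^ b"
    by (metis card_image_le card_lessThan card_mono finite_imageI finite_lessThan order_trans)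
qed

lemma finite_clause_cells: "finite (clause_cells b W c)"
  by (simp add: clause_cells_def finite_lit_cells)

lemma card_clause_cells: "card (clause_cells b W c) \<le> length c * 2 ^ b"
proof -
  have "card (clause_cells b W c) \<le> (\<Sum>l\<in>set c. card (lit_cells b W l))"
    unfolding clause_cells_def by (rule card_UN_le) simp
  also have "\<dots> \<le> card (set c) * 2 ^ b"
    using sum_bounded_above[of "set c" "\<lambda>l. card (lit_cells b W l)"] card_lit_cells by auto
  also have "\<dots> \<le> length c * 2 ^ b" by (simp add: card_length)
  finally show ?thesis .
qed

lemma clause_cells_subset:
  assumes "\<forall>(v, \<beta>)\<in>set c. v < K * b" "2 ^ b \<le> W"
  shows "clause_cells b W c \<subseteq> {..<K * W}"
proof -
  have "(v div b) * W + a < K * W" if "(v, \<beta>) \<in> set c" "a < 2 ^ b" for v \<beta> a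
  proof -
    have "v div b < K" using assms(1) that(1) by (auto simp: less_mult_imp_div_less)
    then have "(v div b + 1) * W \<le> K * W" by (intro mult_right_mono) auto
    then show ?thesis using that(2) assms(2) by simp
  qed
  then show ?thesis by (fastforce simp: clause_cells_def lit_cells_def)
qed

section \<open>Equivalence of the formula and the voting instance\<close>

locale reduction =
  fixes b K W :: nat and cs :: "clause list"
  assumes b: "b \<ge> 1" and W: "W = 3 * 2 ^ b"
    and cs: "\<forall>c\<in>set cs. length c \<le> 3 \<and> (\<forall>(v, \<beta>)\<in>set c. v < K * b)"
begin

definition strings :: "bool list list" where
  "strings = map (\<lambda>c. bits (K * W + W) (padded_cells b W K c)) cs @
     map (\<lambda>g. bits (K * W + W) (row_cells W g)) [0..<K]"

lemma W_ge: "2 ^ b \<le> W" "2 \<le> W" "0 < W"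
  using W by (auto intro: order_trans[OF _ mult_le_mono2[of 1]])

text \<open>Three literals cover at most \<open>3 * 2 ^ b\<close> cells, which is the reason for the
  factor 3 in \<open>W\<close>. The missing ones fit into the \<open>W\<close> positions behind the
  last row, disjoint from the cells of the clause.\<close>

lemma padded_cells:
  assumes "c \<in> set cs"
  shows "padded_cells b W K c \<subseteq> {..<K * W + W}" "card (padded_cells b W K c) = W"
proof -
  let ?A = "clause_cells b W c"
  from assms cs have sub: "?A \<subseteq> {..<K * W}" using clause_cells_subset W_ge by blast
  then show "padded_cells b W K c \<subseteq> {..<K * W + W}" by (auto simp: padded_cells_def)
  from assms cs have "length c \<le> 3" by blast
  then have "card ?A \<le> W"
    using card_clause_cells[of b W c] mult_le_mono1[of "length c" 3 "2 ^ b"] W by linarith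
  moreover have "?A \<inter> {K * W..<K * W + (W - card ?A)} = {}" using sub by auto
  ultimately show "card (padded_cells b W K c) = W"
    by (simp add: padded_cells_def card_Un_disjoint finite_clause_cells)
qed

lemma row_cells:
  assumes "g < K"
  shows "row_cells W g \<subseteq> {..<K * W + W}" "card (row_cells W g) = W"
proof -
  have "(g + 1) * W \<le> K * W" using assms by (intro mult_right_mono) auto
  then show "row_cells W g \<subseteq> {..<K * W + W}" by (auto simp: row_cells_def)
qed (simp add: row_cells_def)

lemma mem_row_cells: "x \<in> row_cells W g \<longleftrightarrow> x div W = g"
proof
  assume "x div W = g"
  then show "x \<in> row_cells W g"
    using div_mult_mod_eq[of x W] mod_less_divisor[OF W_ge(3), of x]
    unfolding row_cells_def atLeastLessThan_iff by (metis add_less_cancel_left le_add1)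
qed (auto simp: row_cells_def intro: div_nat_eqI simp: mult.commute)

text \<open>As all strings have weight \<open>W\<close>, each distance bound says that the ones of
  the solution meet the ones of the string. What remains is a hitting set problem with a prescribed
  size.\<close>

lemma mav_yes_iff_hitting:
  "mav_yes (K * W + W, strings, K, K + W - 2) \<longleftrightarrow>
    (\<exists>S\<subseteq>{..<K * W + W}. card S = K \<and> (\<forall>c\<in>set cs. S \<inter> padded_cells b W K c \<noteq> {}) \<and>
       (\<forall>g<K. S \<inter> row_cells W g \<noteq> {}))" (is "?L \<longleftrightarrow> ?R")
proof -
  let ?m = "K * W + W"
  have iff: "(\<forall>x\<in>#mset strings. hamming_dist s x \<le> K + W - 2) \<longleftrightarrow>
      (\<forall>c\<in>set cs. {i. i < ?m \<and> s ! i} \<inter> padded_cells b W K c \<noteq> {}) \<and>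
      (\<forall>g<K. {i. i < ?m \<and> s ! i} \<inter> row_cells W g \<noteq> {})"
    if "length s = ?m" "count_list s True = K" for s
    using hamming_dist_bits_le_iff[OF that(1) padded_cells that(2) W_ge(2)]
      hamming_dist_bits_le_iff[OF that(1) row_cells that(2) W_ge(2)]
    by (auto simp: strings_def ball_Un)
  show ?thesis
  proof
    assume ?L
    then obtain s where s: "length s = ?m" "count_list s True = K"
      "\<forall>x\<in>#mset strings. hamming_dist s x \<le> K + W - 2"
      by (auto simp: minimax_approval_voting_def)
    have "card {i. i < ?m \<and> s ! i} = K" using s count_list_True by metis
    moreover have "{i. i < ?m \<and> s ! i} \<subseteq> {..<?m}" by auto
    ultimately show ?R using s iff[OF s(1,2)] by blast
  next
    assume ?R
    then obtain S where S: "S \<subseteq> {..<?m}" "card S = K"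
      "\<forall>c\<in>set cs. S \<inter> padded_cells b W K c \<noteq> {}" "\<forall>g<K. S \<inter> row_cells W g \<noteq> {}" by blast
    have *: "{i. i < ?m \<and> bits ?m S ! i} = S" using S(1) by auto
    have "count_list (bits ?m S) True = K" using * S(2) by (simp add: count_list_True)
    with iff[of "bits ?m S"] S(3,4) * show ?L
      unfolding mav_yes.simps minimax_approval_voting_def
      by (intro exI[of _ "bits ?m S"]) simp
  qed
qed

lemma satisfiable_imp_mav_yes:
  assumes "satisfiable (n, cs)"
  shows "mav_yes (K * W + W, strings, K, K + W - 2)"
proof -
  from assms obtain \<alpha> where \<alpha>: "\<forall>c\<in>set cs. \<exists>(v, \<beta>)\<in>set c. \<alpha> v = \<beta>" by auto
  \<comment> \<open>The binary digits of \<open>val g\<close> are the truth values of group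
    \<open>g\<close>. A sum of \<open>b\<close> binary digits is not altered by
    \<open>take_bit b\<close>, which makes the bound \<open>2 ^ b\<close> evident.\<close>
  define val :: "nat \<Rightarrow> nat" where
    "val g = take_bit b (horner_sum of_bool 2 (map (\<lambda>j. \<alpha> (g * b + j)) [0..<b]))" for g
  have val_less: "val g < 2 ^ b" for g
    by (simp add: val_def)
  have val_bit: "odd (val g div 2 ^ j) = \<alpha> (g * b + j)" if "j < b" for g j
    using that by (simp add: val_def bit_horner_sum_bit_iff bit_take_bit_iff flip: bit_iff_odd)
  define S where "S = (\<lambda>g. g * W + val g) ` {..<K}"
  have val_W: "val g < W" for g using val_less[of g] W_ge(1) by linarith
  have row: "g * W + val g \<in> row_cells W g" for g
    using val_W by (simp add: row_cells_def)
  have "inj_on (\<lambda>g. g * W + val g) {..<K}"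
    by (rule inj_onI) (metis row mem_row_cells)
  then have "card S = K" by (simp add: S_def card_image)
  moreover have "S \<subseteq> {..<K * W + W}" using row row_cells(1) by (fastforce simp: S_def)
  moreover have "\<forall>g<K. S \<inter> row_cells W g \<noteq> {}" using row by (auto simp: S_def)
  moreover have "S \<inter> padded_cells b W K c \<noteq> {}" if "c \<in> set cs" for c
  proof -
    from \<alpha> that obtain v where v: "(v, \<alpha> v) \<in> set c" by auto
    with cs that have "v < K * b" by blast
    then have "v div b < K" by (simp add: less_mult_imp_div_less)
    then have "(v div b) * W + val (v div b) \<in> S" by (auto simp: S_def)
    moreover have "(v div b) * W + val (v div b) \<in> lit_cells b W (v, \<alpha> v)"
      using val_less val_bit[of "v mod b" "v div b"] b by (auto simp: lit_cells_def)
    ultimately show ?thesis using v by (auto simp: padded_cells_def clause_cells_def)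
  qed
  ultimately show ?thesis unfolding mav_yes_iff_hitting by blast
qed

text \<open>The rows are disjoint and there are as many of them as selected cells, so every row contains
  exactly one selected cell and the padding contains none.\<close>

lemma mav_yes_imp_satisfiable:
  assumes "mav_yes (K * W + W, strings, K, K + W - 2)"
  shows "satisfiable (n, cs)"
proof -
  from assms obtain S where S: "S \<subseteq> {..<K * W + W}" "card S = K"
    "\<forall>c\<in>set cs. S \<inter> padded_cells b W K c \<noteq> {}" "\<forall>g<K. S \<inter> row_cells W g \<noteq> {}"
    unfolding mav_yes_iff_hitting by blast
  have fin: "finite S" using S(1) finite_subset by blast
  have sub: "{..<K} \<subseteq> (\<lambda>x. x div W) ` S" using S(4) by (fastforce simp: mem_row_cells)
  have "card ((\<lambda>x. x div W) ` S) \<le> K" using card_image_le[OF fin] S(2) by metis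
  with sub fin have img: "(\<lambda>x. x div W) ` S = {..<K}"
    by (metis card_lessThan card_seteq finite_imageI)
  have inj: "inj_on (\<lambda>x. x div W) S"
    by (rule eq_card_imp_inj_on[OF fin]) (simp add: img S(2))
  define \<alpha> where "\<alpha> v \<longleftrightarrow> (\<exists>x\<in>S. x div W = v div b \<and> odd (x mod W div 2 ^ (v mod b)))" for v
  have "\<exists>(v, \<beta>)\<in>set c. \<alpha> v = \<beta>" if c: "c \<in> set cs" for c
  proof -
    from S(3) c obtain x where x: "x \<in> S" "x \<in> padded_cells b W K c" by auto
    have "x div W < K" using img x(1) by auto
    then have "x < K * W" using W_ge(3) by (simp add: div_less_iff_less_mult)
    with x(2) obtain v \<beta> where v: "(v, \<beta>) \<in> set c" "x \<in> lit_cells b W (v, \<beta>)"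
      by (auto simp: padded_cells_def clause_cells_def)
    then obtain a where a: "x = (v div b) * W + a" "a < 2 ^ b" "odd (a div 2 ^ (v mod b)) = \<beta>"
      by (auto simp: lit_cells_def)
    have "a < W" using a(2) W_ge(1) by linarith
    then have "x div W = v div b" "x mod W = a" using a(1) by simp_all
    \<comment> \<open>Injectivity identifies every witness for \<open>\<alpha> v\<close> with
      \<open>x\<close>. For a negative literal this is what excludes a second selected cell of the
      row that would make \<open>v\<close> true.\<close>
    then have "\<alpha> v = \<beta>"
      unfolding \<alpha>_def using x(1) a(3) inj by (metis inj_onD)
    with v(1) show ?thesis by auto
  qed
  then show ?thesis by auto
qed

end

section \<open>Computing the reduction\<close>

text \<open>The preprocessing program never writes register 0, which therefore serves as the constant 0.\<close>

abbreviation (input) "rBase \<equiv> 2 :: reg"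
abbreviation (input) "rOne \<equiv> 3 :: reg"
abbreviation (input) "rN \<equiv> 4 :: reg"
abbreviation (input) "rClauses \<equiv> 5 :: reg"
text \<open>Final contents: \<open>rBits\<close> is the group size \<open>b\<close>,
  \<open>rB\<close> is \<open>2 ^ b\<close>, \<open>rBB\<close> is \<open>2 * b\<close>,
  \<open>rKW\<close> is \<open>K * W\<close> and \<open>rM\<close> is the length of a string.
  \<open>rP\<close> is the reading position, \<open>rOut\<close> the writing position, and
  \<open>rRem\<close> counts the ones a clause string still lacks.\<close>

abbreviation (input) "rBits \<equiv> 6 :: reg"
abbreviation (input) "rB \<equiv> 7 :: reg"
abbreviation (input) "rQ \<equiv> 8 :: reg"
abbreviation (input) "rT \<equiv> 9 :: reg"
abbreviation (input) "rK \<equiv> 10 :: reg"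
abbreviation (input) "rKW \<equiv> 11 :: reg"
abbreviation (input) "rX \<equiv> 12 :: reg"
abbreviation (input) "rW \<equiv> 13 :: reg"
abbreviation (input) "rM \<equiv> 14 :: reg"
abbreviation (input) "rBB \<equiv> 15 :: reg"
abbreviation (input) "rOut \<equiv> 16 :: reg"
abbreviation (input) "rP \<equiv> 17 :: reg"
abbreviation (input) "rLen \<equiv> 18 :: reg"
abbreviation (input) "rRem \<equiv> 19 :: reg"
abbreviation (input) "rL \<equiv> 20 :: reg"
abbreviation (input) "rPos \<equiv> 21 :: reg"
abbreviation (input) "rH \<equiv> 22 :: reg"
abbreviation (input) "rHH \<equiv> 23 :: reg"
abbreviation (input) "rPh \<equiv> 24 :: reg"
abbreviation (input) "rCnt \<equiv> 25 :: reg"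
abbreviation (input) "rU \<equiv> 26 :: reg"
abbreviation (input) "rY \<equiv> 27 :: reg"

text \<open>Division by repeated subtraction on the literal code
  \<open>2 * v + of_bool \<beta>\<close>. Removing \<open>2 * b\<close> moves on by one row;
  removing 2 doubles the bit weight \<open>rH\<close>. The sign of the literal is what remains in
  \<open>rL\<close>. Adding 1 before a truncated subtraction turns it into a test for
  \<open>\<ge>\<close>.\<close>

definition "locate_prog =
  Block [Add rPos rOut 0, Add rT rL rOne, Sub rT rT rBB] ;;
  While rT (Block [Sub rL rL rBB, Add rPos rPos rW, Add rT rL rOne, Sub rT rT rBB]) ;;
  Block [Const rH 1, Sub rT rL rOne] ;;
  While rT (Block [Sub rL rL rOne, Sub rL rL rOne, Add rH rH rH, Sub rT rL rOne])"

text \<open>Register \<open>rPh\<close> runs through \<open>a + z\<close> modulo \<open>2h\<close>, where \<open>h\<close> is the weight of the bit of interest and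
  \<open>z\<close> is 0 for a positive and \<open>h\<close> for a negative literal: the cell of the value \<open>a\<close> is marked iff
  \<open>rPh\<close> is at least \<open>h\<close>. Literals may share cells, so \<open>rRem\<close> is decreased only for new ones.\<close>

definition "mark_prog =
  Block [Add rHH rH rH, Add rPh rH 0, Add rCnt rB 0] ;;
  IfNZ rL (Block [Const rPh 0]) ;;
  While rCnt
   (Block [Add rT rPh rOne, Sub rT rT rH] ;;
    IfNZ rT (Block [Load rU rPos, Sub rT rOne rU, Sub rRem rRem rT, Store rPos rOne]) ;;
    Block [Add rPh rPh rOne, Add rT rPh rOne, Sub rT rT rHH] ;;
    IfNZ rT (Block [Const rPh 0]) ;;
    Block [Add rPos rPos rOne, Sub rCnt rCnt rOne])"

definition "lit_prog = locate_prog ;; mark_prog"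

definition "fill_prog =
  While rRem (Block [Store rPos rOne, Add rPos rPos rOne, Sub rRem rRem rOne])"

definition "clause_prog =
  Block [Load rLen rP, Add rP rP rOne, Add rRem rW 0] ;;
  While rLen (Block [Load rL rP] ;; lit_prog ;; Block [Add rP rP rOne, Sub rLen rLen rOne]) ;;
  Block [Add rPos rOut rKW] ;; fill_prog ;; Block [Add rOut rOut rM]"

lemma writes_progs [simp]:
  "writes locate_prog = {rPos, rT, rL, rH}"
  "writes mark_prog = {rHH, rPh, rCnt, rT, rU, rRem, rPos}"
  "writes lit_prog = {rPos, rT, rL, rH, rHH, rPh, rCnt, rU, rRem}"
  "writes fill_prog = {rPos, rRem}"
  "writes clause_prog = {rLen, rP, rRem, rL, rPos, rT, rH, rHH, rPh, rCnt, rU, rOut}"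
  by (auto simp: locate_prog_def mark_prog_def lit_prog_def fill_prog_def clause_prog_def)

section \<open>Writing the string of one clause\<close>

lemma locate_prog:
  assumes R: "R rOne = 1" "R 0 = 0" "R rL = 2 * v + of_bool \<beta>" "R rBB = 2 * b" "R rW = W"
    and b: "b \<ge> 1" and N: "v div b \<le> N" "b \<le> N"
  shows "achieves locate_prog (R, M) (12 * N + 7) (\<lambda>R' M'. M' = M \<and>
    R' rPos = R rOut + (v div b) * W \<and> R' rL = of_bool \<beta> \<and> R' rH = 2 ^ (v mod b))"
proof -
  have vb: "v mod b < b" using b by simp
  define I where "I = (\<lambda>k R' M'. M' = M \<and> R' rPos + k * W = R rOut + (v div b) * W \<and>
    R' rL = 2 * (k * b + v mod b) + of_bool \<beta> \<and> R' rT = R' rL + 1 - 2 * b)"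
  define J where "J = (\<lambda>k R' M'. M' = M \<and> R' rPos = R rOut + (v div b) * W \<and>
    R' rL = 2 * k + of_bool \<beta> \<and> R' rT = R' rL - 1 \<and> R' rH * 2 ^ k = 2 ^ (v mod b))"
  show ?thesis
    unfolding locate_prog_def
  proof (rule achieves_Seq[where T = 3 and T' = "12 * N + 4" and Q = "I (v div b)"])
    show "achieves (Block [Add rPos rOut 0, Add rT rL rOne, Sub rT rT rBB]) (R, M) 3 (I (v div b))"
      by (rule achieves_Block, simp_all add: I_def R) (metis distrib_left div_mult_mod_eq)
  next
    fix R1 M1
    assume 1: "I (v div b) R1 M1"
      and "\<forall>r. r \<notin> writes (Block [Add rPos rOut 0, Add rT rL rOne, Sub rT rT rBB]) \<longrightarrow> R1 r = fst (R, M) r"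
    then have R1: "R1 rOne = 1" "R1 rBB = 2 * b" "R1 rW = W" using R by simp_all
    let ?w = "While rT (Block [Sub rL rL rBB, Add rPos rPos rW, Add rT rL rOne, Sub rT rT rBB])"
    show "achieves (?w ;; Block [Const rH 1, Sub rT rL rOne] ;;
       While rT (Block [Sub rL rL rOne, Sub rL rL rOne, Add rH rH rH, Sub rT rL rOne]))
       (R1, M1) (12 * N + 4) (\<lambda>R' M'. M' = M \<and> R' rPos = R rOut + (v div b) * W \<and>
         R' rL = of_bool \<beta> \<and> R' rH = 2 ^ (v mod b))"
    proof (rule achieves_Seq[where T = "6 * N + 1" and T' = "6 * N + 3" and Q = "I 0"])
      show "achieves ?w (R1, M1) (6 * N + 1) (I 0)"
      proof (rule achieves_While[where T = 4 and k = "v div b"])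
        show "I (v div b) (fst (R1, M1)) (snd (R1, M1))" using 1 by simp
        show "(4 + 2) * (v div b) + 1 \<le> 6 * N + 1" using N by simp
      next
        fix k R2 M2
        assume I: "I (Suc k) R2 M2"
          and "\<forall>x. x \<notin> writes (Block [Sub rL rL rBB, Add rPos rPos rW, Add rT rL rOne, Sub rT rT rBB])
            \<longrightarrow> R2 x = fst (R1, M1) x"
        then have R2: "R2 rOne = 1" "R2 rBB = 2 * b" "R2 rW = W" using R1 by simp_all
        have "achieves (Block [Sub rL rL rBB, Add rPos rPos rW, Add rT rL rOne, Sub rT rT rBB])
            (R2, M2) 4 (I k)"
          using I by (intro achieves_Block) (simp_all add: I_def R2 algebra_simps)
        then show "R2 rT \<noteq> 0 \<and>
          achieves (Block [Sub rL rL rBB, Add rPos rPos rW, Add rT rL rOne, Sub rT rT rBB]) (R2, M2) 4 (I k)"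
          using I by (simp add: I_def)
      next
        fix R2 M2 assume "I 0 R2 M2"
        \<comment> \<open>Since \<open>v mod b \<le> b - 1\<close>, the remainder including the sign
          bit is at most \<open>2 * b - 1\<close>, so even after adding 1 the truncated difference
          vanishes.\<close>
        then show "R2 rT = 0" using vb by (auto simp: I_def of_bool_def)
      qed
    next
      fix R2 M2
      assume I: "I 0 R2 M2" and "\<forall>r. r \<notin> writes ?w \<longrightarrow> R2 r = fst (R1, M1) r"
      then have R2: "R2 rOne = 1" using R1 by simp
      show "achieves (Block [Const rH 1, Sub rT rL rOne] ;;
        While rT (Block [Sub rL rL rOne, Sub rL rL rOne, Add rH rH rH, Sub rT rL rOne])) (R2, M2) (6 * N + 3)
        (\<lambda>R' M'. M' = M \<and> R' rPos = R rOut + (v div b) * W \<and> R' rL = of_bool \<beta> \<and> R' rH = 2 ^ (v mod b))"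
      proof (rule achieves_Seq[where T = 2 and T' = "6 * N + 1" and Q = "J (v mod b)"])
        show "achieves (Block [Const rH 1, Sub rT rL rOne]) (R2, M2) 2 (J (v mod b))"
          using I by (intro achieves_Block) (simp_all add: I_def J_def R2)
      next
        fix R3 M3
        assume J: "J (v mod b) R3 M3"
          and "\<forall>r. r \<notin> writes (Block [Const rH 1, Sub rT rL rOne]) \<longrightarrow> R3 r = fst (R2, M2) r"
        then have R3: "R3 rOne = 1" using R2 by simp
        let ?B = "Block [Sub rL rL rOne, Sub rL rL rOne, Add rH rH rH, Sub rT rL rOne]"
        have "achieves (While rT ?B) (R3, M3) (6 * N + 1) (J 0)"
        proof (rule achieves_While[where T = 4 and k = "v mod b"])
          show "J (v mod b) (fst (R3, M3)) (snd (R3, M3))" using J by simp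
          show "(4 + 2) * (v mod b) + 1 \<le> 6 * N + 1" using vb N by simp
        next
          fix k R4 M4
          assume J: "J (Suc k) R4 M4" and "\<forall>x. x \<notin> writes ?B \<longrightarrow> R4 x = fst (R3, M3) x"
          then have R4: "R4 rOne = 1" using R3 by simp
          have "achieves ?B (R4, M4) 4 (J k)"
            using J by (intro achieves_Block) (simp_all add: J_def R4 algebra_simps)
          then show "R4 rT \<noteq> 0 \<and> achieves ?B (R4, M4) 4 (J k)"
            using J by (simp add: J_def)
        next
          fix R4 M4 assume "J 0 R4 M4"
          then show "R4 rT = 0" by (simp add: J_def of_bool_def)
        qed
        then show "achieves (While rT ?B) (R3, M3) (6 * N + 1) (\<lambda>R' M'. M' = M \<and>
            R' rPos = R rOut + (v div b) * W \<and> R' rL = of_bool \<beta> \<and> R' rH = 2 ^ (v mod b))"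
          by (rule achieves_mono) (simp_all add: J_def)
      qed simp
    qed simp
  qed simp
qed

text \<open>A partly written string as the set of its ones relative to its start. Marking a cell
  twice is then a harmless set insertion, as happens when literals share cells.\<close>

definition marked :: "mem \<Rightarrow> nat \<Rightarrow> nat set \<Rightarrow> mem" where
  "marked M S A = (\<lambda>i. if S \<le> i \<and> i - S \<in> A then 1 else M i)"

lemma marked_upd: "(marked M S A)(S + x := Suc 0) = marked M S (insert x A)"
  by (auto simp: marked_def fun_eq_iff)

lemma marked_at: "M (S + x) = 0 \<Longrightarrow> marked M S A (S + x) = of_bool (x \<in> A)"
  by (auto simp: marked_def)

text \<open>A bit test without division: the bit of weight \<open>h\<close> is set iff the residue
  modulo \<open>2 * h\<close> lies in the upper half, because this residue is
  \<open>h * (x div h mod 2) + x mod h\<close>.\<close>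

lemma le_mod_double_iff_odd_div:
  fixes x h :: nat
  assumes "h > 0"
  shows "h \<le> x mod (2 * h) \<longleftrightarrow> odd (x div h)"
proof -
  have "x mod (2 * h) = h * (x div h mod 2) + x mod h"
    using mod_mult2_eq[of x h 2] by (simp add: mult.commute)
  moreover have "x mod h < h" using assms by simp
  ultimately show ?thesis by (cases "odd (x div h)") (auto simp: odd_iff_mod_2_eq_one even_iff_mod_2_eq_zero)
qed

lemma mark_prog:
  fixes r A
  assumes R: "R rOne = 1" "R 0 = 0" "R rL = of_bool \<beta>" "R rH = h" "R rB = B" "R rPos = S + r"
      "R rRem = w - card A"
    and h: "h > 0" and A: "finite A" and M: "\<And>i. S \<le> i \<Longrightarrow> M i = 0" and N: "B \<le> N"
  defines "A' \<equiv> A \<union> {r + a |a. a < B \<and> odd (a div h) = \<beta>}"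
  shows "achieves mark_prog (R, marked M S A) (16 * N + 6)
    (\<lambda>R' M'. M' = marked M S A' \<and> R' rRem = w - card A')"
proof -
  define z where "z = (if \<beta> then 0 else h)"
  define D where "D k = A \<union> {r + a |a. a < k \<and> odd ((a + z) div h)}" for k
  have D0: "D 0 = A" by (simp add: D_def)
  have DS: "D (Suc k) = (if odd ((k + z) div h) then insert (r + k) (D k) else D k)" for k
    by (auto simp: D_def less_Suc_eq)
  have fin: "finite (D k)" for k by (induction k) (simp_all add: D0 A DS)
  \<comment> \<open>Adding \<open>h\<close> raises the quotient by one and so flips its parity; one
    test thus serves both signs.\<close>
  have "odd ((a + z) div h) \<longleftrightarrow> odd (a div h) = \<beta>" for a using h by (simp add: z_def)
  then have DB: "D B = A'" by (simp add: D_def A'_def)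
  define I where "I = (\<lambda>k R' M'. \<exists>a. a + k = B \<and> R' rCnt = k \<and> R' rPos = S + (r + a) \<and>
    R' rPh = (a + z) mod (2 * h) \<and> M' = marked M S (D a) \<and> R' rRem = w - card (D a))"
  let ?init = "Block [Add rHH rH rH, Add rPh rH 0, Add rCnt rB 0]"
  let ?b1 = "Block [Add rT rPh rOne, Sub rT rT rH]"
  let ?b2 = "IfNZ rT (Block [Load rU rPos, Sub rT rOne rU, Sub rRem rRem rT, Store rPos rOne])"
  let ?b3 = "Block [Add rPh rPh rOne, Add rT rPh rOne, Sub rT rT rHH]"
  let ?b4 = "IfNZ rT (Block [Const rPh 0])"
  let ?b5 = "Block [Add rPos rPos rOne, Sub rCnt rCnt rOne]"
  let ?body = "?b1 ;; ?b2 ;; ?b3 ;; ?b4 ;; ?b5"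
  have body: "achieves ?body (R1, M1) 14 (I k)"
    if R1: "R1 rOne = 1" "R1 rH = h" "R1 rHH = 2 * h" and I: "I (Suc k) R1 M1" for k R1 M1
  proof -
    from I obtain a where a: "a + Suc k = B" "R1 rCnt = Suc k" "R1 rPos = S + (r + a)"
      "R1 rPh = (a + z) mod (2 * h)" "M1 = marked M S (D a)" "R1 rRem = w - card (D a)"
      unfolding I_def by blast
    let ?ph = "(a + z) mod (2 * h)"
    have ph: "?ph < 2 * h" using h by simp
    define Q where "Q = (\<lambda>R' M'. R' rOne = 1 \<and> R' rHH = 2 * h \<and> R' rCnt = Suc k \<and>
      R' rPos = S + (r + a) \<and> R' rPh = ?ph \<and>
      M' = marked M S (D (Suc a)) \<and> R' rRem = w - card (D (Suc a)))"
    show ?thesis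
    proof (rule achieves_Seq[where T = 2 and T' = 12])
      show "achieves ?b1 (R1, M1) 2 (\<lambda>R' M'. R' = R1(rT := Suc ?ph - h) \<and> M' = M1)"
        by (rule achieves_Block) (simp_all add: R1 a)
    next
      fix R2 M2 assume R2: "R2 = R1(rT := Suc ?ph - h) \<and> M2 = M1"
      show "achieves (?b2 ;; ?b3 ;; ?b4 ;; ?b5) (R2, M2) 12 (I k)"
      proof (rule achieves_Seq[where T = 5 and T' = 7 and Q = Q])
        show "achieves ?b2 (R2, M2) 5 Q"
        proof (rule achieves_IfNZ[where T = 4])
          assume "fst (R2, M2) rT = 0"
          then have "even ((a + z) div h)"
            using R2 le_mod_double_iff_odd_div[OF h, of "a + z"] by auto
          then show "case_prod Q (R2, M2)" using R2 R1 a by (simp add: Q_def DS)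
        next
          assume "fst (R2, M2) rT \<noteq> 0"
          then have odd: "odd ((a + z) div h)"
            using R2 le_mod_double_iff_odd_div[OF h, of "a + z"] by auto
          \<comment> \<open>The cardinality grows by 1 only for a new cell, and this is the value
            \<open>rOne - rU\<close> that the program subtracts from \<open>rRem\<close>.\<close>
          have c: "card (insert (r + a) (D a)) = card (D a) + (1 - of_bool (r + a \<in> D a))"
            using fin by (simp add: insert_absorb)
          show "achieves (Block [Load rU rPos, Sub rT rOne rU, Sub rRem rRem rT, Store rPos rOne])
              (R2, M2) 4 Q"
            using R2 R1 a odd c
            by (intro achieves_Block) (simp_all add: Q_def DS marked_upd marked_at M)
        qed simp
      next
        fix R3 M3 assume Q: "Q R3 M3"
        show "achieves (?b3 ;; ?b4 ;; ?b5) (R3, M3) 7 (I k)"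
        proof (rule achieves_Seq[where T = 3 and T' = 4])
          show "achieves ?b3 (R3, M3) 3 (\<lambda>R' M'. M' = M3 \<and>
            R' = R3(rPh := Suc ?ph, rT := Suc (Suc ?ph) - 2 * h))"
            by (rule achieves_Block) (use Q in \<open>simp_all add: Q_def fun_upd_twist\<close>)
        next
          fix R4 M4 assume R4: "M4 = M3 \<and> R4 = R3(rPh := Suc ?ph, rT := Suc (Suc ?ph) - 2 * h)"
          let ?Q4 = "\<lambda>R' M'. M' = M3 \<and> R' rOne = 1 \<and> R' rCnt = Suc k \<and>
            R' rPos = S + (r + a) \<and> R' rPh = (Suc a + z) mod (2 * h) \<and>
            R' rRem = w - card (D (Suc a))"
          show "achieves (?b4 ;; ?b5) (R4, M4) 4 (I k)"
          proof (rule achieves_Seq[where T = 2 and T' = 2 and Q = ?Q4])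
            show "achieves ?b4 (R4, M4) 2 ?Q4"
            proof (rule achieves_IfNZ[where T = 1])
              assume "fst (R4, M4) rT = 0"
              \<comment> \<open>Because \<open>?ph < 2 * h\<close>, the truncated difference in
                \<open>rT\<close> is nonzero exactly when the incremented phase reaches
                \<open>2 * h\<close> and has to wrap around.\<close>
              then have "Suc ?ph \<noteq> 2 * h" using R4 ph by auto
              then show "case_prod ?Q4 (R4, M4)" using Q R4 by (simp add: Q_def mod_Suc)
            next
              assume "fst (R4, M4) rT \<noteq> 0"
              then have "Suc ?ph = 2 * h" using R4 ph by auto
              then show "achieves (Block [Const rPh 0]) (R4, M4) 1 ?Q4"
                using Q R4 by (intro achieves_Block) (simp_all add: Q_def mod_Suc)
            qed simp
          next
            fix R5 M5 assume "?Q4 R5 M5"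
            then show "achieves ?b5 (R5, M5) 2 (I k)"
              using Q a(1) by (intro achieves_Block) (auto simp: I_def Q_def intro!: exI[of _ "Suc a"])
          qed simp
        qed simp
      qed simp
    qed simp
  qed
  show ?thesis
    unfolding mark_prog_def
  proof (rule achieves_Seq[where T = 3 and T' = "16 * N + 3"])
    show "achieves ?init (R, marked M S A) 3 (\<lambda>R' M'. M' = marked M S A \<and>
        R' = R(rHH := 2 * h, rPh := h, rCnt := B))"
      by (rule achieves_Block) (simp_all add: R mult_2)
  next
    fix R1 M1 assume R1: "M1 = marked M S A \<and> R1 = R(rHH := 2 * h, rPh := h, rCnt := B)"
    show "achieves (IfNZ rL (Block [Const rPh 0]) ;; While rCnt ?body) (R1, M1) (16 * N + 3)
        (\<lambda>R' M'. M' = marked M S A' \<and> R' rRem = w - card A')"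
    proof (rule achieves_Seq[where T = 2 and T' = "16 * N + 1"])
      let ?Q = "\<lambda>R' M'. M' = marked M S A \<and> R' = R(rHH := 2 * h, rPh := z, rCnt := B)"
      show "achieves (IfNZ rL (Block [Const rPh 0])) (R1, M1) 2 ?Q"
      proof (rule achieves_IfNZ[where T = 1])
        assume "fst (R1, M1) rL = 0"
        then show "case_prod ?Q (R1, M1)" using R1 R by (simp add: z_def split: if_splits)
      next
        assume "fst (R1, M1) rL \<noteq> 0"
        then show "achieves (Block [Const rPh 0]) (R1, M1) 1 ?Q"
          using R1 R by (intro achieves_Block) (auto simp: z_def)
      qed simp
    next
      fix R2 M2 assume R2: "M2 = marked M S A \<and> R2 = R(rHH := 2 * h, rPh := z, rCnt := B)"
      have "achieves (While rCnt ?body) (R2, M2) (16 * N + 1) (I 0)"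
      proof (rule achieves_While[where T = 14 and k = B])
        have "z mod (2 * h) = z" using h by (simp add: z_def)
        then show "I B (fst (R2, M2)) (snd (R2, M2))"
          using R2 R by (auto simp: I_def D0)
        show "(14 + 2) * B + 1 \<le> 16 * N + 1" using N by simp
      next
        fix k R3 M3
        assume I: "I (Suc k) R3 M3" and "\<forall>x. x \<notin> writes ?body \<longrightarrow> R3 x = fst (R2, M2) x"
        then have "R3 rOne = 1" "R3 rH = h" "R3 rHH = 2 * h" using R2 R by simp_all
        from body[OF this I] I show "R3 rCnt \<noteq> 0 \<and> achieves ?body (R3, M3) 14 (I k)"
          by (auto simp: I_def)
      qed (auto simp: I_def)
      then show "achieves (While rCnt ?body) (R2, M2) (16 * N + 1)
          (\<lambda>R' M'. M' = marked M S A' \<and> R' rRem = w - card A')"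
        by (rule achieves_mono) (auto simp: I_def DB)
    qed simp
  qed simp
qed


lemma lit_prog:
  assumes R: "R rOne = 1" "R 0 = 0" "R rL = 2 * v + of_bool \<beta>" "R rBB = 2 * b" "R rW = W"
      "R rB = 2 ^ b" "R rOut = S" "R rRem = w - card A"
    and b: "b \<ge> 1" and N: "v div b \<le> N" "2 ^ b \<le> N"
    and A: "finite A" and M: "\<And>i. S \<le> i \<Longrightarrow> M i = 0"
  defines "A' \<equiv> A \<union> lit_cells b W (v, \<beta>)"
  shows "achieves lit_prog (R, marked M S A) (28 * N + 13)
    (\<lambda>R' M'. M' = marked M S A' \<and> R' rRem = w - card A')"
proof -
  have bN: "b \<le> N" using N(2) less_exp[of b] by linarith
  show ?thesis
    unfolding lit_prog_def
  proof (rule achieves_Seq[OF locate_prog[OF R(1-5) b N(1) bN], where T' = "16 * N + 6"])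
    fix R1 M1
    assume 1: "M1 = marked M S A \<and> R1 rPos = R rOut + v div b * W \<and> R1 rL = of_bool \<beta> \<and> R1 rH = 2 ^ (v mod b)"
      and "\<forall>r. r \<notin> writes locate_prog \<longrightarrow> R1 r = fst (R, marked M S A) r"
    then have R1: "R1 rOne = 1" "R1 0 = 0" "R1 rB = 2 ^ b" "R1 rRem = w - card A" using R by simp_all
    have "A' = A \<union> {v div b * W + a |a. a < 2 ^ b \<and> odd (a div 2 ^ (v mod b)) = \<beta>}"
      by (simp add: A'_def lit_cells_def)
    with mark_prog[of R1 \<beta> "2 ^ (v mod b)" "2 ^ b" S "v div b * W" w A M N] 1 R1 A M N(2) R(7)
    show "achieves mark_prog (R1, M1) (16 * N + 6)
       (\<lambda>R' M'. M' = marked M S A' \<and> R' rRem = w - card A')" by simp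
  qed simp
qed

lemma fill_prog:
  assumes R: "R rOne = 1" "R rPos = S + q" "R rRem = x" and N: "x \<le> N"
  shows "achieves fill_prog (R, marked M S A) (5 * N + 1) (\<lambda>R' M'. M' = marked M S (A \<union> {q..<q + x}))"
proof -
  define I where "I = (\<lambda>k R' M'. \<exists>y. y + k = x \<and> R' rRem = k \<and> R' rPos = S + (q + y) \<and>
    M' = marked M S (A \<union> {q..<q + y}))"
  let ?b = "Block [Store rPos rOne, Add rPos rPos rOne, Sub rRem rRem rOne]"
  have "achieves fill_prog (R, marked M S A) (5 * N + 1) (I 0)"
    unfolding fill_prog_def
  proof (rule achieves_While[where T = 3 and k = x])
    show "I x (fst (R, marked M S A)) (snd (R, marked M S A))" using R by (simp add: I_def)
    show "(3 + 2) * x + 1 \<le> 5 * N + 1" using N by simp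
  next
    fix k R1 M1 assume I: "I (Suc k) R1 M1"
      and "\<forall>r. r \<notin> writes ?b \<longrightarrow> R1 r = fst (R, marked M S A) r"
    then have R1: "R1 rOne = 1" using R by simp
    from I obtain y where y: "y + Suc k = x" "R1 rRem = Suc k" "R1 rPos = S + (q + y)"
      "M1 = marked M S (A \<union> {q..<q + y})" by (auto simp: I_def)
    have "insert (q + y) (A \<union> {q..<q + y}) = A \<union> {q..<q + Suc y}" by auto
    then have "achieves ?b (R1, M1) 3 (I k)"
      using y(1) by (intro achieves_Block)
       (simp_all add: I_def R1 y marked_upd exI[of _ "Suc y"])
    with y show "R1 rRem \<noteq> 0 \<and> achieves ?b (R1, M1) 3 (I k)" by simp
  qed (auto simp: I_def)
  then show ?thesis by (rule achieves_mono) (auto simp: I_def)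
qed

text \<open>Invariants describe the reading position by the unread suffix of the input; this yields
  the cell to be read and the suffix after it.\<close>

lemma drop_eq_ConsD: "drop p xs = y # ys \<Longrightarrow> p < length xs \<and> xs ! p = y \<and> drop (Suc p) xs = ys"
  by (metis Cons_nth_drop_Suc drop_all leI list.distinct(1) list.inject)

lemma clause_cells_snoc: "clause_cells b W (c @ [l]) = clause_cells b W c \<union> lit_cells b W l"
  by (auto simp: clause_cells_def)

lemma clause_prog:
  assumes R: "R rOne = 1" "R 0 = 0" "R rBB = 2 * b" "R rW = W" "R rB = 2 ^ b" "R rKW = K * W"
      "R rM = m" "R rOut = S"
    and b: "b \<ge> 1" and N: "K \<le> N" "2 ^ b \<le> N" "W \<le> 3 * N"
    and xs: "drop (R rP) xs = encode_clause c @ zs" "length xs \<le> S" "\<And>i. i < length xs \<Longrightarrow> M i = xs ! i"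
    and M: "\<And>i. S \<le> i \<Longrightarrow> M i = 0"
    and c: "length c \<le> 3" "\<forall>(v, \<beta>)\<in>set c. v < K * b"
  shows "achieves clause_prog (R, M) (200 * N)
    (\<lambda>R' M'. M' = marked M S (padded_cells b W K c) \<and> drop (R' rP) xs = zs \<and> R' rOut = S + m)"
proof -
  have N1: "N \<ge> 1" using N(2) one_le_power[of "2 :: nat" b] by linarith
  let ?code = "\<lambda>(v, \<beta>). 2 * v + of_bool \<beta>"
  define I where "I = (\<lambda>k R' M'. \<exists>c1 c2. c = c1 @ c2 \<and> length c2 = k \<and> R' rLen = k \<and>
    drop (R' rP) xs = map ?code c2 @ zs \<and> M' = marked M S (clause_cells b W c1) \<and>
    R' rRem = W - card (clause_cells b W c1))"
  \<comment> \<open>The input lies entirely below the output address \<open>S\<close>, so partial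
    output never disturbs later reads.\<close>
  have readM: "marked M S A i = xs ! i" if "i < length xs" for A i
    using that xs(2,3) by (simp add: marked_def)
  let ?b1 = "Block [Load rLen rP, Add rP rP rOne, Add rRem rW 0]"
  let ?b2 = "Block [Load rL rP] ;; lit_prog ;; Block [Add rP rP rOne, Sub rLen rLen rOne]"
  let ?Q = "\<lambda>R' M'. M' = marked M S (padded_cells b W K c) \<and> drop (R' rP) xs = zs \<and> R' rOut = S + m"
  have body: "R1 rLen \<noteq> 0 \<and> achieves ?b2 (R1, M1) (28 * N + 16) (I k)"
    if I: "I (Suc k) R1 M1" and u: "\<forall>r. r \<notin> writes ?b1 \<union> writes ?b2 \<longrightarrow> R1 r = R r" for k R1 M1
  proof -
    from I obtain c1 c2 where c12: "c = c1 @ c2" "length c2 = Suc k" "R1 rLen = Suc k"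
      "drop (R1 rP) xs = map ?code c2 @ zs" "M1 = marked M S (clause_cells b W c1)"
      "R1 rRem = W - card (clause_cells b W c1)" unfolding I_def by blast
    then obtain v \<beta> c3 where c3: "c2 = (v, \<beta>) # c3" by (metis length_Suc_conv surj_pair)
    have v: "v < K * b" using c(2) c12(1) c3 by auto
    then have vK: "v div b \<le> N" using N(1) less_mult_imp_div_less[of v K b] by linarith
    from c12(4) c3 have p: "R1 rP < length xs" "xs ! (R1 rP) = 2 * v + of_bool \<beta>"
      "drop (Suc (R1 rP)) xs = map ?code c3 @ zs"
      using drop_eq_ConsD[of "R1 rP" xs "2 * v + of_bool \<beta>"] by simp_all
    have R1: "R1 rOne = 1" "R1 0 = 0" "R1 rBB = 2 * b" "R1 rW = W" "R1 rB = 2 ^ b" "R1 rOut = S"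
      using u R by simp_all
    have "achieves ?b2 (R1, M1) (28 * N + 16) (I k)"
    proof (rule achieves_Seq[where T = 1 and T' = "28 * N + 15"])
      show "achieves (Block [Load rL rP]) (R1, M1) 1
          (\<lambda>R' M'. M' = M1 \<and> R' = R1(rL := 2 * v + of_bool \<beta>))"
        by (rule achieves_Block) (simp_all add: c12(5) readM p)
    next
      fix R2 M2 assume R2: "M2 = M1 \<and> R2 = R1(rL := 2 * v + of_bool \<beta>)"
      show "achieves (lit_prog ;; Block [Add rP rP rOne, Sub rLen rLen rOne]) (R2, M2) (28 * N + 15) (I k)"
        unfolding conjunct1[OF R2] c12(5)
      proof (rule achieves_Seq[OF lit_prog[where v = v and \<beta> = \<beta> and b = b and W = W and S = S and
              w = W and A = "clause_cells b W c1" and N = N and M = M and R = R2], where T' = 2])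
        fix R3 M3
        assume 3: "M3 = marked M S (clause_cells b W c1 \<union> lit_cells b W (v, \<beta>)) \<and>
            R3 rRem = W - card (clause_cells b W c1 \<union> lit_cells b W (v, \<beta>))"
          and "\<forall>r. r \<notin> writes lit_prog \<longrightarrow> R3 r = fst (R2, marked M S (clause_cells b W c1)) r"
        then have R3: "R3 rOne = 1" "R3 rP = R1 rP" "R3 rLen = Suc k" using R2 R1 c12 by simp_all
        have "I k (R3(rP := Suc (R1 rP), rLen := k)) M3"
          unfolding I_def using 3 p(3) c12(1,2) c3
          by (intro exI[of _ "c1 @ [(v, \<beta>)]"] exI[of _ c3]) (simp add: clause_cells_snoc)
        then show "achieves (Block [Add rP rP rOne, Sub rLen rLen rOne]) (R3, M3) 2 (I k)"
          by (intro achieves_Block) (simp_all add: R3)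
      qed (use R1 R2 c12 b vK N finite_clause_cells M in simp_all)
    qed simp
    with c12(3) show ?thesis by simp
  qed
  show ?thesis
    unfolding clause_prog_def
  proof (rule achieves_Seq[where T = 3 and T' = "197 * N"])
    from xs(1) drop_eq_ConsD[of "R rP" xs "length c" "map ?code c @ zs"]
    have p: "R rP < length xs" "xs ! (R rP) = length c" "drop (Suc (R rP)) xs = map ?code c @ zs"
      by simp_all
    have "marked M S (clause_cells b W []) = M" by (simp add: marked_def clause_cells_def)
    then have "I (length c) (R(rLen := length c, rP := Suc (R rP), rRem := W)) M"
      unfolding I_def by (intro exI[of _ "[]"] exI[of _ c]) (simp add: p clause_cells_def)
    then show "achieves ?b1 (R, M) 3 (I (length c))"
      by (intro achieves_Block) (simp_all add: R xs(3) p)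
  next
    fix R1 M1 assume 1: "I (length c) R1 M1" and u1: "\<forall>r. r \<notin> writes ?b1 \<longrightarrow> R1 r = fst (R, M) r"
    show "achieves (While rLen ?b2 ;; Block [Add rPos rOut rKW] ;; fill_prog ;; Block [Add rOut rOut rM])
       (R1, M1) (197 * N) ?Q"
    proof (rule achieves_Seq[where T = "(28 * N + 18) * 3 + 1" and T' = "15 * N + 3"])
      show "achieves (While rLen ?b2) (R1, M1) ((28 * N + 18) * 3 + 1) (I 0)"
      proof (rule achieves_While[where T = "28 * N + 16" and k = "length c"])
        show "(28 * N + 16 + 2) * length c + 1 \<le> (28 * N + 18) * 3 + 1"
          using c(1) by (intro add_right_mono mult_le_mono) simp_all
        show "I (length c) (fst (R1, M1)) (snd (R1, M1))" using 1 by simp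
        show "R2 rLen = 0" if "I 0 R2 M2" for R2 M2 using that unfolding I_def by blast
      next
        fix k R2 M2 assume "I (Suc k) R2 M2" "\<forall>x. x \<notin> writes ?b2 \<longrightarrow> R2 x = fst (R1, M1) x"
        then show "R2 rLen \<noteq> 0 \<and> achieves ?b2 (R2, M2) (28 * N + 16) (I k)"
          using u1 by (intro body) simp_all
      qed
    next
      fix R2 M2 assume 2: "I 0 R2 M2" and u2: "\<forall>r. r \<notin> writes (While rLen ?b2) \<longrightarrow> R2 r = fst (R1, M1) r"
      have R2: "R2 rOne = 1" "R2 rOut = S" "R2 rM = m" "R2 rKW = K * W" using u1 u2 R by simp_all
      from 2 have I2: "drop (R2 rP) xs = zs" "M2 = marked M S (clause_cells b W c)"
        "R2 rRem = W - card (clause_cells b W c)" by (auto simp: I_def)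
      show "achieves (Block [Add rPos rOut rKW] ;; fill_prog ;; Block [Add rOut rOut rM]) (R2, M2) (15 * N + 3) ?Q"
      proof (rule achieves_Seq[where T = 1 and T' = "15 * N + 2"])
        show "achieves (Block [Add rPos rOut rKW]) (R2, M2) 1 (\<lambda>R' M'. M' = M2 \<and> R' = R2(rPos := S + K * W))"
          by (rule achieves_Block) (simp_all add: R2)
      next
        fix R3 M3 assume 3: "M3 = M2 \<and> R3 = R2(rPos := S + K * W)"
        show "achieves (fill_prog ;; Block [Add rOut rOut rM]) (R3, M3) (15 * N + 2) ?Q"
          unfolding conjunct1[OF 3] I2
        proof (rule achieves_Seq[OF fill_prog[where q = "K * W" and N = "3 * N" and
                x = "W - card (clause_cells b W c)"], where T' = 1])
          fix R4 M4
          assume M4: "M4 = marked M S (clause_cells b W c \<union> {K * W..<K * W + (W - card (clause_cells b W c))})"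
            and "\<forall>r. r \<notin> writes fill_prog \<longrightarrow> R4 r = fst (R3, marked M S (clause_cells b W c)) r"
          then have "R4 rOut = S" "R4 rM = m" "R4 rP = R2 rP" using 3 R2 by simp_all
          then show "achieves (Block [Add rOut rOut rM]) (R4, M4) 1 ?Q"
            by (intro achieves_Block) (simp_all add: M4 I2 padded_cells_def)
        qed (use 3 R2 I2 N in simp_all)
      qed simp
    qed (use N1 in simp)
  qed (use N1 in simp)
qed

section \<open>Writing the strings of all clauses and rows\<close>

definition lay :: "mem \<Rightarrow> nat \<Rightarrow> nat list \<Rightarrow> mem" where
  "lay M S xs = (\<lambda>i. if S \<le> i \<and> i < S + length xs then xs ! (i - S) else M i)"

lemma lay_Nil [simp]: "lay M S [] = M"
  by (auto simp: lay_def)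

lemma lay_append: "lay (lay M S xs) (S + length xs) ys = lay M S (xs @ ys)"
  by (auto simp: lay_def nth_append fun_eq_iff)

lemma lay_outside: "i < S \<or> S + length xs \<le> i \<Longrightarrow> lay M S xs i = M i"
  by (auto simp: lay_def)

text \<open>Only ones are ever stored: the zeros of a string are supplied by the memory from
  \<open>S\<close> on, which is still blank.\<close>

lemma marked_eq_lay:
  assumes "A \<subseteq> {..<m}" "\<And>i. S \<le> i \<Longrightarrow> M i = 0"
  shows "marked M S A = lay M S (map of_bool (bits m A))"
  using assms by (auto simp: lay_def marked_def fun_eq_iff)

lemma length_concat_bits: "length (concat (map (\<lambda>x. bits m (f x)) xs)) = length xs * m"
  by (induction xs) simp_all

definition "clauses_prog = While rClauses (clause_prog ;; Block [Sub rClauses rClauses rOne])"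

definition "rows_prog =
  Block [Const rY 0, Add rX rK 0] ;;
  While rX
   (Block [Add rRem rW 0, Add rPos rOut rY] ;; fill_prog ;;
    Block [Add rOut rOut rM, Add rY rY rW, Sub rX rX rOne])"

lemma writes_loops [simp]:
  "writes clauses_prog = insert rClauses (writes clause_prog)"
  "writes rows_prog = {rY, rX, rRem, rPos, rOut}"
  by (auto simp: clauses_prog_def rows_prog_def)

context reduction
begin

abbreviation (input) "m \<equiv> K * W + W"

lemma clauses_prog:
  assumes R: "R rOne = 1" "R 0 = 0" "R rBB = 2 * b" "R rW = W" "R rB = 2 ^ b" "R rKW = K * W"
      "R rM = m" "R rOut = S" "R rClauses = length cs"
    and N: "K \<le> N" "2 ^ b \<le> N"
    and xs: "drop (R rP) xs = concat (map encode_clause cs)" "length xs \<le> S"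
      "\<And>i. i < length xs \<Longrightarrow> M i = xs ! i"
    and M: "\<And>i. S \<le> i \<Longrightarrow> M i = 0"
  defines "out \<equiv> \<lambda>cs. map of_bool (concat (map (\<lambda>c. bits m (padded_cells b W K c)) cs)) :: nat list"
  shows "achieves clauses_prog (R, M) ((200 * N + 3) * length cs + 1)
    (\<lambda>R' M'. M' = lay M S (out cs) \<and> R' rOut = S + length (out cs))"
proof -
  have len: "length (out c1) = length c1 * m" for c1
    by (simp add: out_def length_concat_bits)
  define I where "I = (\<lambda>k R' M'. \<exists>c1 c2. cs = c1 @ c2 \<and> length c2 = k \<and> R' rClauses = k \<and>
    drop (R' rP) xs = concat (map encode_clause c2) \<and> M' = lay M S (out c1) \<and>
    R' rOut = S + length (out c1))"
  let ?b = "clause_prog ;; Block [Sub rClauses rClauses rOne]"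
  have "achieves clauses_prog (R, M) ((200 * N + 3) * length cs + 1) (I 0)"
    unfolding clauses_prog_def
  proof (rule achieves_While[where T = "200 * N + 1" and k = "length cs"])
    show "I (length cs) (fst (R, M)) (snd (R, M))"
      unfolding I_def using R xs(1)
      by (intro exI[of _ "[]"] exI[of _ cs]) (simp add: out_def)
    show "R1 rClauses = 0" if "I 0 R1 M1" for R1 M1 using that unfolding I_def by blast
    show "(200 * N + 1 + 2) * length cs + 1 \<le> (200 * N + 3) * length cs + 1"
      by (intro add_right_mono mult_le_mono) simp_all
  next
    fix k R1 M1
    assume I: "I (Suc k) R1 M1" and u: "\<forall>x. x \<notin> writes ?b \<longrightarrow> R1 x = fst (R, M) x"
    from I obtain c1 c2 where c12: "cs = c1 @ c2" "length c2 = Suc k" "R1 rClauses = Suc k"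
      "drop (R1 rP) xs = concat (map encode_clause c2)" "M1 = lay M S (out c1)"
      "R1 rOut = S + length (out c1)" unfolding I_def by blast
    then obtain c c3 where c3: "c2 = c # c3" by (metis length_Suc_conv)
    have R1: "R1 rOne = 1" "R1 0 = 0" "R1 rBB = 2 * b" "R1 rW = W" "R1 rB = 2 ^ b" "R1 rKW = K * W"
      "R1 rM = m" using u R by simp_all
    have c: "c \<in> set cs" using c12(1) c3 by simp
    then have c': "length c \<le> 3" "\<forall>(v, \<beta>)\<in>set c. v < K * b" using cs by blast+
    have d: "drop (R1 rP) xs = encode_clause c @ concat (map encode_clause c3)"
      using c12(4) c3 by simp
    have WN: "W \<le> 3 * N" using W N by simp
    have len': "length xs \<le> S + length (out c1)" using xs(2) by simp
    have M1: "M1 i = 0" if "S + length (out c1) \<le> i" for i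
      using that M by (simp add: c12(5) lay_outside)
    have read: "M1 i = xs ! i" if "i < length xs" for i
      using that xs(2,3) by (simp add: c12(5) lay_outside)
    have "achieves ?b (R1, M1) (200 * N + 1) (I k)"
    proof (rule achieves_Seq[OF clause_prog[OF R1 c12(6) b N WN d len' read M1 c'], where T' = 1])
      fix R2 M2
      assume 2: "M2 = marked M1 (S + length (out c1)) (padded_cells b W K c) \<and>
          drop (R2 rP) xs = concat (map encode_clause c3) \<and> R2 rOut = S + length (out c1) + m"
        and "\<forall>r. r \<notin> writes clause_prog \<longrightarrow> R2 r = fst (R1, M1) r"
      then have R2: "R2 rOne = 1" "R2 rClauses = Suc k" using R1 c12(3) by simp_all
      have "M2 = lay M S (out (c1 @ [c]))"
      proof -
        have "M2 = lay M1 (S + length (out c1)) (map of_bool (bits m (padded_cells b W K c)))"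
          using 2 padded_cells(1)[OF c] M1 by (simp add: marked_eq_lay)
        also have "\<dots> = lay M S (out (c1 @ [c]))"
          unfolding c12(5) lay_append by (simp add: out_def)
        finally show ?thesis .
      qed
      then have "I k (R2(rClauses := k)) M2"
        unfolding I_def using 2 c12(1,2) c3
        by (intro exI[of _ "c1 @ [c]"] exI[of _ c3]) (simp add: len)
      then show "achieves (Block [Sub rClauses rClauses rOne]) (R2, M2) 1 (I k)"
        by (intro achieves_Block) (simp_all add: R2)
    qed simp_all
    with c12(3) show "R1 rClauses \<noteq> 0 \<and> achieves ?b (R1, M1) (200 * N + 1) (I k)" by simp
  qed
  then show ?thesis by (rule achieves_mono) (auto simp: I_def)
qed

lemma rows_prog:
  assumes R: "R rOne = 1" "R 0 = 0" "R rW = W" "R rM = m" "R rOut = S" "R rK = K"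
    and N: "W \<le> 3 * N"
    and M: "\<And>i. S \<le> i \<Longrightarrow> M i = 0"
  defines "out \<equiv> \<lambda>k. map of_bool (concat (map (\<lambda>g. bits m (row_cells W g)) [0..<k])) :: nat list"
  shows "achieves rows_prog (R, M) ((15 * N + 8) * K + 3) (\<lambda>R' M'. M' = lay M S (out K))"
proof -
  have len: "length (out k) = k * m" for k
    unfolding out_def length_map length_concat_bits by simp
  define I where "I = (\<lambda>k R' M'. \<exists>g. g + k = K \<and> R' rX = k \<and> R' rY = g * W \<and> R' rOut = S + length (out g) \<and>
    M' = lay M S (out g))"
  let ?b1 = "Block [Add rRem rW 0, Add rPos rOut rY]"
  let ?b2 = "Block [Add rOut rOut rM, Add rY rY rW, Sub rX rX rOne]"
  let ?b = "?b1 ;; fill_prog ;; ?b2"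
  show ?thesis
    unfolding rows_prog_def
  proof (rule achieves_Seq[where T = 2 and T' = "(15 * N + 8) * K + 1" and Q = "I K"])
    show "achieves (Block [Const rY 0, Add rX rK 0]) (R, M) 2 (I K)"
      by (rule achieves_Block) (simp_all add: I_def R out_def)
  next
    fix R1 M1
    assume 1: "I K R1 M1" and "\<forall>r. r \<notin> writes (Block [Const rY 0, Add rX rK 0]) \<longrightarrow> R1 r = fst (R, M) r"
    then have R1: "R1 rOne = 1" "R1 0 = 0" "R1 rW = W" "R1 rM = m" using R by simp_all
    have "achieves (While rX ?b) (R1, M1) ((15 * N + 8) * K + 1) (I 0)"
    proof (rule achieves_While[where T = "15 * N + 6" and k = K])
      show "I K (fst (R1, M1)) (snd (R1, M1))" using 1 by simp
      show "R2 rX = 0" if "I 0 R2 M2" for R2 M2 using that by (auto simp: I_def)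
      show "(15 * N + 6 + 2) * K + 1 \<le> (15 * N + 8) * K + 1"
        by (intro add_right_mono mult_le_mono) simp_all
    next
      fix k R2 M2
      assume I: "I (Suc k) R2 M2" and "\<forall>x. x \<notin> writes ?b \<longrightarrow> R2 x = fst (R1, M1) x"
      then have R2: "R2 rOne = 1" "R2 0 = 0" "R2 rW = W" "R2 rM = m" using R1 by simp_all
      from I obtain g where g: "g + Suc k = K" "R2 rX = Suc k" "R2 rY = g * W"
        "R2 rOut = S + length (out g)" "M2 = lay M S (out g)" by (auto simp: I_def)
      have M2: "M2 i = 0" if "S + length (out g) \<le> i" for i
        using that M by (simp add: g(5) lay_outside)
      have "achieves ?b (R2, M2) (15 * N + 6) (I k)"
      proof (rule achieves_Seq[where T = 2 and T' = "15 * N + 4"])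
        \<comment> \<open>Viewing the untouched memory as a marking of the empty set brings it into
          the form that the specification of \<open>fill_prog\<close> expects.\<close>
        show "achieves ?b1 (R2, M2) 2 (\<lambda>R' M'. M' = marked M2 (S + length (out g)) {} \<and>
          R' = R2(rRem := W, rPos := S + length (out g) + g * W))"
          by (rule achieves_Block) (simp_all add: R2 g marked_def)
      next
        fix R3 M3
        assume 3: "M3 = marked M2 (S + length (out g)) {} \<and>
          R3 = R2(rRem := W, rPos := S + length (out g) + g * W)"
        show "achieves (fill_prog ;; ?b2) (R3, M3) (15 * N + 4) (I k)"
          unfolding conjunct1[OF 3]
        proof (rule achieves_Seq[OF fill_prog[where q = "g * W" and x = W and N = "3 * N"], where T' = 3])
          fix R4 M4
          assume M4: "M4 = marked M2 (S + length (out g)) ({} \<union> {g * W..<g * W + W})"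
            and "\<forall>r. r \<notin> writes fill_prog \<longrightarrow> R4 r = fst (R3, marked M2 (S + length (out g)) {}) r"
          then have R4: "R4 rOne = 1" "R4 rM = m" "R4 rW = W" "R4 rOut = S + length (out g)"
            "R4 rY = g * W" "R4 rX = Suc k" using 3 R2 g by simp_all
          have "M4 = marked M2 (S + length (out g)) (row_cells W g)"
            using M4 by (simp add: row_cells_def)
          also have "\<dots> = lay M2 (S + length (out g)) (map of_bool (bits m (row_cells W g)))"
            using row_cells(1)[of g] g(1) M2 by (intro marked_eq_lay) simp_all
          also have "\<dots> = lay M S (out (Suc g))"
            unfolding g(5) lay_append by (simp add: out_def)
          finally have "M4 = lay M S (out (Suc g))" .
          then show "achieves ?b2 (R4, M4) 3 (I k)"
            using g(1) by (intro achieves_Block)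
              (simp_all add: R4 I_def len exI[of _ "Suc g"])
        qed (use 3 R2 N in simp_all)
      qed simp
      with g(2) show "R2 rX \<noteq> 0 \<and> achieves ?b (R2, M2) (15 * N + 6) (I k)" by simp
    qed
    then show "achieves (While rX ?b) (R1, M1) ((15 * N + 8) * K + 1) (\<lambda>R' M'. M' = lay M S (out K))"
      by (rule achieves_mono) (auto simp: I_def)
  qed simp
qed

end

section \<open>Group size, dimensions and header of the instance\<close>

definition group_size :: "nat \<Rightarrow> nat" where
  "group_size n = (LEAST b. 1 \<le> b \<and> n < 4 ^ b)"

text \<open>The bound \<open>4 ^ b\<close> instead of \<open>2 ^ b\<close> makes \<open>b\<close>
  about half of \<open>log n\<close>, so that \<open>b * 2 ^ b\<close> stays linear in
  \<open>n\<close>. The candidate \<open>Suc n\<close> shows that the minimum exists.\<close>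

lemma group_size: "1 \<le> group_size n" "n < 4 ^ group_size n"
proof -
  have "n < 2 ^ n" by (rule less_exp)
  also have "(2 :: nat) ^ n \<le> 4 ^ Suc n" by (rule order_trans[OF power_mono[of 2 4]]) simp_all
  finally have "1 \<le> Suc n \<and> n < 4 ^ Suc n" by simp
  from LeastI[of "\<lambda>b. 1 \<le> b \<and> n < 4 ^ b", OF this]
  show "1 \<le> group_size n" "n < 4 ^ group_size n" by (simp_all add: group_size_def)
qed

lemma less_group_size: "1 \<le> i \<Longrightarrow> i < group_size n \<Longrightarrow> 4 ^ i \<le> n"
  unfolding group_size_def using not_less_Least by (metis (mono_tags, lifting) leI)

text \<open>By minimality the preceding exponent satisfies \<open>4 ^ (b - 1) \<le> n\<close>,
  unless \<open>b = 1\<close>; the summand 4 covers that case.\<close>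

lemma four_power_group_size: "4 ^ group_size n \<le> 4 * n + 4"
proof (cases "group_size n = 1")
  case False
  then obtain i where i: "group_size n = Suc i" "1 \<le> i"
    using group_size(1)[of n] by (cases "group_size n") auto
  with less_group_size[of i n] show ?thesis by simp
qed simp

lemma two_power_group_size: "2 ^ group_size n \<le> 4 * n + 4"
  by (rule order_trans[OF power_mono four_power_group_size]) simp_all

text \<open>The powers \<open>2 ^ b\<close> and \<open>4 ^ b\<close> arise by doubling,
  \<open>K\<close> and \<open>K * W\<close> by counting subtractions. Since \<open>rX\<close> starts
  at \<open>n + 1\<close>, removing \<open>b\<close> until nothing is left takes exactly
  \<open>n div b + 1\<close> rounds.\<close>

definition "size_prog =
  Block [Const rOne 1, Load rN 0, Load rClauses rOne, Const rBits 1, Const rB 2, Const rQ 4,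
    Add rT rN rOne, Sub rT rT rQ] ;;
  While rT (Block [Add rBits rBits rOne, Add rB rB rB, Add rQ rQ rQ, Add rQ rQ rQ,
    Add rT rN rOne, Sub rT rT rQ]) ;;
  Block [Add rW rB rB, Add rW rW rB, Add rBB rBits rBits, Const rK 0, Const rKW 0,
    Add rX rN rOne] ;;
  While rX (Block [Sub rX rX rBits, Add rK rK rOne, Add rKW rKW rW])"

text \<open>For \<open>c\<close> clauses the output starts at address \<open>4 * c + 2\<close>, which lies beyond the input: each clause
  occupies at most four cells.\<close>

definition "header_prog =
  Block [Add rM rKW rW, Add rBase rClauses rClauses, Add rBase rBase rBase,
    Add rBase rBase rOne, Add rBase rBase rOne,
    Add rT rClauses rK, Add rOut rBase 0, Store rOut rT,
    Add rOut rOut rOne, Store rOut rM,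
    Add rOut rOut rOne, Store rOut rK,
    Add rT rK rW, Sub rT rT rOne, Sub rT rT rOne, Add rOut rOut rOne, Store rOut rT,
    Add rOut rOut rOne, Const rP 2]"

lemma writes_header [simp]:
  "writes size_prog = {rOne, rN, rClauses, rBits, rB, rQ, rT, rW, rBB, rK, rKW, rX}"
  "writes header_prog = {rM, rBase, rT, rOut, rP}"
  by (auto simp: size_prog_def header_prog_def)

lemma size_prog:
  assumes R: "R 0 = 0" and M: "M 0 = n" "M 1 = c"
  defines "b \<equiv> group_size n"
  defines "W \<equiv> 3 * 2 ^ b" and "K \<equiv> n div b + 1"
  assumes N: "K \<le> N" "2 ^ b \<le> N"
  shows "achieves size_prog (R, M) (13 * N + 16) (\<lambda>R' M'. M' = M \<and> R' rOne = 1 \<and>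
    R' rClauses = c \<and> R' rB = 2 ^ b \<and> R' rBB = 2 * b \<and> R' rK = K \<and> R' rW = W \<and> R' rKW = K * W)"
proof -
  have b: "1 \<le> b" "n < 4 ^ b" using group_size b_def by auto
  have bN: "b \<le> N" using N(2) less_exp[of b] by linarith
  let ?b1 = "Block [Const rOne 1, Load rN 0, Load rClauses rOne, Const rBits 1, Const rB 2, Const rQ 4,
    Add rT rN rOne, Sub rT rT rQ]"
  let ?b2 = "Block [Add rBits rBits rOne, Add rB rB rB, Add rQ rQ rQ, Add rQ rQ rQ,
    Add rT rN rOne, Sub rT rT rQ]"
  let ?b3 = "Block [Add rW rB rB, Add rW rW rB, Add rBB rBits rBits, Const rK 0, Const rKW 0,
    Add rX rN rOne]"
  let ?b4 = "Block [Sub rX rX rBits, Add rK rK rOne, Add rKW rKW rW]"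
  define F where "F = (\<lambda>R' M'. M' = M \<and> R' rOne = 1 \<and> R' rN = n \<and> R' rClauses = c)"
  define I where "I = (\<lambda>k R' M'. F R' M' \<and> (\<exists>i. 1 \<le> i \<and> i + k = b \<and> R' rBits = i \<and> R' rB = 2 ^ i \<and>
    R' rQ = 4 ^ i \<and> R' rT = Suc n - 4 ^ i))"
  define J where "J = (\<lambda>k R' M'. F R' M' \<and> R' rB = 2 ^ b \<and> R' rBits = b \<and> R' rBB = 2 * b \<and> R' rW = W \<and>
    (\<exists>i. i + k = K \<and> R' rX = Suc n - i * b \<and> R' rK = i \<and> R' rKW = i * W))"
  let ?Q = "\<lambda>R' M'. M' = M \<and> R' rOne = 1 \<and>
    R' rClauses = c \<and> R' rB = 2 ^ b \<and> R' rBB = 2 * b \<and> R' rK = K \<and> R' rW = W \<and> R' rKW = K * W"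
  show ?thesis
    unfolding size_prog_def
  proof (rule achieves_Seq[where T = 8 and T' = "13 * N + 8" and Q = "I (b - 1)"])
    show "achieves ?b1 (R, M) 8 (I (b - 1))"
      using b(1) M by (intro achieves_Block) (simp_all add: I_def F_def R)
  next
    fix R1 M1 assume 1: "I (b - 1) R1 M1"
    show "achieves (While rT ?b2 ;; ?b3 ;; While rX ?b4) (R1, M1) (13 * N + 8) ?Q"
    proof (rule achieves_Seq[where T = "8 * N + 1" and T' = "5 * N + 7" and Q = "I 0"])
      show "achieves (While rT ?b2) (R1, M1) (8 * N + 1) (I 0)"
      proof (rule achieves_While[where T = 6 and k = "b - 1"])
        show "I (b - 1) (fst (R1, M1)) (snd (R1, M1))" using 1 by simp
        show "(6 + 2) * (b - 1) + 1 \<le> 8 * N + 1" using bN by simp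
      next
        fix k R2 M2 assume I: "I (Suc k) R2 M2"
        then obtain i where i: "1 \<le> i" "i + Suc k = b" "R2 rBits = i" "R2 rB = 2 ^ i"
          "R2 rQ = 4 ^ i" "R2 rT = Suc n - 4 ^ i" and F: "F R2 M2" by (auto simp: I_def)
        \<comment> \<open>Minimality of \<open>b\<close> keeps the loop running as long as
          \<open>i < b\<close>.\<close>
        have "4 ^ i \<le> n" using less_group_size[OF i(1), of n] i(2) by (simp add: b_def)
        moreover have "achieves ?b2 (R2, M2) 6 (I k)"
          using F i(1,2) by (intro achieves_Block) (simp_all add: I_def F_def i exI[of _ "Suc i"])
        ultimately show "R2 rT \<noteq> 0 \<and> achieves ?b2 (R2, M2) 6 (I k)" using i(6) by simp
      next
        fix R2 M2 assume "I 0 R2 M2"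
        then show "R2 rT = 0" using b(2) by (auto simp: I_def)
      qed
    next
      fix R2 M2 assume "I 0 R2 M2"
      then have 2: "F R2 M2" "R2 rBits = b" "R2 rB = 2 ^ b" by (auto simp: I_def)
      show "achieves (?b3 ;; While rX ?b4) (R2, M2) (5 * N + 7) ?Q"
      proof (rule achieves_Seq[where T = 6 and T' = "5 * N + 1" and Q = "J K"])
        show "achieves ?b3 (R2, M2) 6 (J K)"
          using 2 by (intro achieves_Block) (simp_all add: J_def F_def W_def)
      next
        fix R3 M3 assume 3: "J K R3 M3"
        have "achieves (While rX ?b4) (R3, M3) (5 * N + 1) (J 0)"
        proof (rule achieves_While[where T = 3 and k = K])
          show "J K (fst (R3, M3)) (snd (R3, M3))" using 3 by simp
          show "(3 + 2) * K + 1 \<le> 5 * N + 1" using N by simp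
        next
          fix k R4 M4 assume J: "J (Suc k) R4 M4"
          then obtain i where i: "i + Suc k = K" "R4 rX = Suc n - i * b" "R4 rK = i" "R4 rKW = i * W"
            and F: "F R4 M4" "R4 rB = 2 ^ b" "R4 rBits = b" "R4 rBB = 2 * b" "R4 rW = W"
            by (auto simp: J_def)
          have "i * b \<le> (n div b) * b" using i(1) by (intro mult_right_mono) (simp_all add: K_def)
          also have "\<dots> \<le> n" by simp
          finally have "R4 rX \<noteq> 0" using i(2) by simp
          moreover have "achieves ?b4 (R4, M4) 3 (J k)"
            using F i(1) by (intro achieves_Block) (simp_all add: J_def F_def i exI[of _ "Suc i"])
          ultimately show "R4 rX \<noteq> 0 \<and> achieves ?b4 (R4, M4) 3 (J k)" by simp
        next
          fix R4 M4 assume "J 0 R4 M4"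
          \<comment> \<open>Strictness gives \<open>n + 1 \<le> K * b\<close>, so the truncated
            difference is zero after \<open>K\<close> rounds.\<close>
          moreover have "n < K * b" using b(1) by (simp add: K_def add.commute dividend_less_div_times)
          ultimately show "R4 rX = 0" by (auto simp: J_def)
        qed
        then show "achieves (While rX ?b4) (R3, M3) (5 * N + 1) ?Q"
          by (rule achieves_mono) (auto simp: J_def F_def)
      qed simp
    qed simp
  qed simp
qed

lemma header_prog:
  assumes R: "R 0 = 0" "R rOne = 1" "R rClauses = c" "R rK = K" "R rW = W" "R rKW = K * W"
  shows "achieves header_prog (R, M) 19 (\<lambda>R' M'. M' = lay M (4 * c + 2) [c + K, K * W + W, K, K + W - 2] \<and>
    R' rM = K * W + W \<and> R' rBase = 4 * c + 2 \<and> R' rOut = 4 * c + 6 \<and> R' rP = 2)"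
proof -
  have 1: "lay M B [w, x, y, z] =
      M(B := w, Suc B := x, Suc (Suc B) := y, Suc (Suc (Suc B)) := z)" for B w x y z
    by (auto simp: lay_def fun_eq_iff less_Suc_eq nth_Cons')
  have 2: "c + c + (c + c) = 4 * c" by simp
  show ?thesis
    unfolding header_prog_def 1
    by (rule achieves_Block, simp_all add: R 2) (simp add: numeral_2_eq_2)
qed

section \<open>The complete preprocessing program\<close>

definition "build_prog = size_prog ;; header_prog ;; clauses_prog ;; rows_prog"

fun reduce :: "sat_instance \<Rightarrow> mav_instance" where
  "reduce (n, cs) =
    (let b = group_size n; W = 3 * 2 ^ b; K = n div b + 1
     in (K * W + W, reduction.strings b K W cs, K, K + W - 2))"

text \<open>The last group may reach beyond the \<open>n\<close> variables. The surplus ones occur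
  in no clause, so it suffices that \<open>n < K * b\<close>.\<close>

lemma reduction_group_size:
  assumes "(n, cs) \<in> three_sat_instances"
  shows "reduction (group_size n) (n div group_size n + 1) (3 * 2 ^ group_size n) cs"
proof
  show "\<forall>c\<in>set cs. length c \<le> 3 \<and> (\<forall>(v, \<beta>)\<in>set c. v < (n div group_size n + 1) * group_size n)"
  proof (intro ballI conjI)
    fix c assume c: "c \<in> set cs"
    with assms show "length c \<le> 3" by (auto simp: three_sat_instances_def)
    have "n < (n div group_size n + 1) * group_size n"
      using group_size(1)[of n] by (simp add: add.commute dividend_less_div_times)
    moreover from c assms have "\<forall>(v, \<beta>)\<in>set c. v < n" by (auto simp: three_sat_instances_def)
    ultimately show "case l of (v, \<beta>) \<Rightarrow> v < (n div group_size n + 1) * group_size n" if "l \<in> set c" for l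
      using that by fastforce
  qed
qed (use group_size(1)[of n] in simp_all)

lemma mav_yes_reduce:
  assumes "(n, cs) \<in> three_sat_instances"
  shows "mav_yes (reduce (n, cs)) \<longleftrightarrow> satisfiable (n, cs)"
proof -
  interpret reduction "group_size n" "n div group_size n + 1" "3 * 2 ^ group_size n" cs
    by (rule reduction_group_size[OF assms])
  show ?thesis
    using satisfiable_imp_mav_yes[of n] mav_yes_imp_satisfiable[of n] by (auto simp: Let_def)
qed

text \<open>The upper bound places the input below the output address; the lower bound lets the
  number of clauses be charged to the input size.\<close>

lemma length_encode_sat:
  assumes "(n, cs) \<in> three_sat_instances"
  shows "length (encode_sat (n, cs)) \<le> 4 * length cs + 2" "length cs + 2 \<le> length (encode_sat (n, cs))"
proof -
  have "\<forall>c\<in>set cs. length c \<le> 3" using assms by (auto simp: three_sat_instances_def)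
  then have "length (concat (map encode_clause cs)) \<le> 4 * length cs \<and>
      length cs \<le> length (concat (map encode_clause cs))"
    by (induction cs) auto
  then show "length (encode_sat (n, cs)) \<le> 4 * length cs + 2" "length cs + 2 \<le> length (encode_sat (n, cs))"
    by simp_all
qed

lemma build_prog:
  assumes inst: "(n, cs) \<in> three_sat_instances"
  defines "N \<equiv> 4 * n + 4" and "ys \<equiv> encode_mav (reduce (n, cs))"
  shows "achieves build_prog (snd (init (encode_sat (n, cs)))) (300 * N * (N + length cs))
    (\<lambda>R M. (\<forall>r. R (sim_reg r) = 0) \<and> (\<forall>i. M (R 2 + i) = (if i < length ys then ys ! i else 0)))"
proof -
  define b where "b = group_size n"
  define W where "W = 3 * (2 :: nat) ^ b"
  define K where "K = n div b + 1"
  interpret reduction b K W cs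
    using reduction_group_size[OF inst] by (simp add: b_def W_def K_def)
  let ?m = "K * W + W"
  define xs where "xs = encode_sat (n, cs)"
  define M where "M = (\<lambda>i. if i < length xs then xs ! i else 0)"
  define base where "base = 4 * length cs + 2"
  define out1 :: "nat list" where "out1 = map of_bool (concat (map (\<lambda>c. bits ?m (padded_cells b W K c)) cs))"
  define out2 :: "nat list" where "out2 = map of_bool (concat (map (\<lambda>g. bits ?m (row_cells W g)) [0..<K]))"
  define hd where "hd = [length cs + K, ?m, K, K + W - 2]"
  have "reduce (n, cs) = (?m, strings, K, K + W - 2)"
    unfolding reduce.simps Let_def b_def[symmetric] W_def[symmetric] K_def[symmetric] ..
  then have ys: "ys = hd @ out1 @ out2"
    by (simp add: ys_def hd_def out1_def out2_def strings_def)
  have xs_le: "length xs \<le> base" using length_encode_sat[OF inst] by (simp add: xs_def base_def)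
  have Mz: "M i = 0" if "base \<le> i" for i using that xs_le by (simp add: M_def)
  have KN: "K \<le> N" by (simp add: K_def N_def le_SucI div_le_dividend order_trans[OF div_le_dividend])
  have BN: "2 ^ b \<le> N" using two_power_group_size by (simp add: b_def N_def)
  then have WN: "W \<le> 3 * N" by (simp add: W_def)
  have N4: "4 \<le> N" by (simp add: N_def)
  have init: "snd (init xs) = ((\<lambda>_. 0), M)" by (simp add: init_def M_def)
  have time: "13 * N + 16 + (19 + ((200 * N + 3) * length cs + 1 + ((15 * N + 8) * K + 3)))
      \<le> 300 * N * (N + length cs)"
  proof -
    have "(15 * N + 8) * K \<le> (17 * N) * N" using N4 KN by (intro mult_le_mono) simp_all
    also have "\<dots> = 17 * (N * N)" by simp
    finally have "(15 * N + 8) * K \<le> 17 * (N * N)" .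
    moreover have "(200 * N + 3) * length cs \<le> 300 * N * length cs" using N4 by (intro mult_le_mono1) simp
    moreover have "13 * N + 39 \<le> 23 * (N * N)" using N4 mult_le_mono1[OF N4, of N] by linarith
    moreover have "300 * N * (N + length cs) = 300 * (N * N) + 300 * N * length cs"
      by (simp add: distrib_left)
    ultimately show ?thesis by linarith
  qed
  have "achieves build_prog ((\<lambda>_. 0), M) (300 * N * (N + length cs))
    (\<lambda>R' M'. R' rBase = base \<and> M' = lay M base ys)"
    unfolding build_prog_def
  proof (rule achieves_Seq[OF size_prog[where n = n and c = "length cs" and N = N] time])
    fix R1 M1
    assume 1: "M1 = M \<and> R1 rOne = 1 \<and> R1 rClauses = length cs \<and> R1 rB = 2 ^ group_size n \<and>
        R1 rBB = 2 * group_size n \<and> R1 rK = n div group_size n + 1 \<and>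
        R1 rW = 3 * 2 ^ group_size n \<and> R1 rKW = (n div group_size n + 1) * (3 * 2 ^ group_size n)"
      and "\<forall>r. r \<notin> writes size_prog \<longrightarrow> R1 r = fst (\<lambda>_. 0, M) r"
    then have R1: "R1 rOne = 1" "R1 0 = 0" "R1 rBB = 2 * b" "R1 rW = W" "R1 rB = 2 ^ b" "R1 rKW = K * W"
      "R1 rClauses = length cs" "R1 rK = K" by (simp_all add: b_def W_def K_def)
    show "achieves (header_prog ;; clauses_prog ;; rows_prog) (R1, M1)
       (19 + ((200 * N + 3) * length cs + 1 + ((15 * N + 8) * K + 3)))
       (\<lambda>R' M'. R' rBase = base \<and> M' = lay M base ys)"
    proof (rule achieves_Seq[OF header_prog[OF R1(2,1,7,8,4,6)] order_refl])
      fix R2 M2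
      assume 2: "M2 = lay M1 (4 * length cs + 2) [length cs + K, K * W + W, K, K + W - 2] \<and>
          R2 rM = K * W + W \<and> R2 rBase = 4 * length cs + 2 \<and> R2 rOut = 4 * length cs + 6 \<and> R2 rP = 2"
        and "\<forall>r. r \<notin> writes header_prog \<longrightarrow> R2 r = fst (R1, M1) r"
      then have R2: "R2 rOne = 1" "R2 0 = 0" "R2 rBB = 2 * b" "R2 rW = W" "R2 rB = 2 ^ b" "R2 rKW = K * W"
        "R2 rM = ?m" "R2 rOut = base + length hd" "R2 rClauses = length cs" and R2': "R2 rK = K" "R2 rBase = base"
        using R1 by (simp_all add: base_def hd_def)
      from 2 1 have M2: "M2 = lay M base hd" by (simp add: base_def hd_def)
      have d: "drop (R2 rP) xs = concat (map encode_clause cs)" using 2 by (simp add: xs_def)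
      have len: "length xs \<le> base + length hd" using xs_le by simp
      have read: "M2 i = xs ! i" if "i < length xs" for i
        using that xs_le by (simp add: M2 lay_outside) (simp add: M_def)
      have M2z: "M2 i = 0" if "base + length hd \<le> i" for i using that Mz by (simp add: M2 lay_outside)
      show "achieves (clauses_prog ;; rows_prog) (R2, M2)
          ((200 * N + 3) * length cs + 1 + ((15 * N + 8) * K + 3))
          (\<lambda>R' M'. R' rBase = base \<and> M' = lay M base ys)"
      proof (rule achieves_Seq[OF clauses_prog[OF R2 KN BN d len read M2z] order_refl])
        fix R3 M3
        assume 3: "M3 = lay M2 (base + length hd)
            (map of_bool (concat (map (\<lambda>c. bits ?m (padded_cells b W K c)) cs))) \<and>
            R3 rOut = base + length hd +
              length (map of_bool (concat (map (\<lambda>c. bits ?m (padded_cells b W K c)) cs)) :: nat list)"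
          and "\<forall>r. r \<notin> writes clauses_prog \<longrightarrow> R3 r = fst (R2, M2) r"
        then have R3: "R3 rOne = 1" "R3 0 = 0" "R3 rW = W" "R3 rM = ?m"
          "R3 rOut = base + length (hd @ out1)" "R3 rK = K" and R3': "R3 rBase = base"
          using R2 R2' by (simp_all add: out1_def)
        have M3: "M3 = lay M base (hd @ out1)" using 3 by (simp add: M2 lay_append out1_def)
        have M3z: "M3 i = 0" if "base + length (hd @ out1) \<le> i" for i
          using that Mz lay_outside[of i base "hd @ out1" M] by (simp add: M3)
        show "achieves rows_prog (R3, M3) ((15 * N + 8) * K + 3)
            (\<lambda>R' M'. R' rBase = base \<and> M' = lay M base ys)"
        proof (rule achieves_mono[OF rows_prog[OF R3 WN M3z] order_refl])
          fix R4 M4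
          assume "M4 = lay M3 (base + length (hd @ out1))
              (map of_bool (concat (map (\<lambda>g. bits ?m (row_cells W g)) [0..<K])))"
            and "\<forall>r. r \<notin> writes rows_prog \<longrightarrow> R4 r = fst (R3, M3) r"
          then show "R4 rBase = base \<and> M4 = lay M base ys"
            using R3' by (simp only: M3 lay_append ys flip: out2_def) simp
        qed
      qed simp_all
    qed
  qed (use KN BN inst in \<open>simp_all add: b_def K_def M_def xs_def\<close>)
  then show ?thesis
    unfolding xs_def[symmetric] init
  proof (rule achieves_mono)
    fix R' M'
    assume "R' rBase = base \<and> M' = lay M base ys"
      and u: "\<forall>r. r \<notin> writes build_prog \<longrightarrow> R' r = fst (\<lambda>_. 0, M) r"
    \<comment> \<open>Register 0 and the registers above 30 are never written, so the simulated
      program finds all of its registers zero.\<close>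
    moreover have "sim_reg r \<notin> writes build_prog" for r
      by (simp add: build_prog_def sim_reg_def)
    ultimately show "(\<forall>r. R' (sim_reg r) = 0) \<and>
        (\<forall>i. M' (R' 2 + i) = (if i < length ys then ys ! i else 0))"
      using Mz by (simp add: lay_def)
  qed simp
qed

section \<open>Running times\<close>

lemma answers_within_mono: "answers_within P xs T b \<Longrightarrow> T \<le> T' \<Longrightarrow> answers_within P xs T' b"
  unfolding answers_within_def by (meson order_trans)

text \<open>From \<open>d \<le> 4 * 4 ^ b \<le> 2 ^ (4 * b)\<close> the logarithm is at most
  \<open>4 * b\<close>. This cancels the denominator in \<open>d \<le> n / b + 3 * 2 ^ b\<close>,
  and \<open>b * 2 ^ b \<le> 4 ^ b \<le> 4 * n + 4\<close> bounds the rest: in total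
  \<open>4 * n + 12 * (4 * n + 4)\<close>.\<close>

lemma reduced_distance_bound:
  fixes n :: nat
  defines "b \<equiv> group_size n"
  defines "d \<equiv> n div b + 1 + 3 * 2 ^ b - 2"
  shows "1 \<le> d" "real d * log 2 (real d) \<le> 52 * (real n + 1)"
proof -
  have b: "1 \<le> b" "n < 4 ^ b" using group_size b_def by auto
  have le4: "(2 :: nat) ^ b \<le> 4 ^ b" by (rule power_mono) simp_all
  have ge2: "(2 :: nat) ^ 1 \<le> 2 ^ b" by (rule power_increasing[OF b(1)]) simp
  then show d1: "1 \<le> d" by (simp add: d_def)
  have "n div b \<le> n" by simp
  then have "d \<le> 4 * 4 ^ b" using le4 b(2) unfolding d_def by linarith
  also have "\<dots> = 2 ^ (2 * b + 2)" by (simp add: power_mult)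
  also have "\<dots> \<le> 2 ^ (4 * b)" using b(1) by (intro power_increasing) simp_all
  finally have "real d \<le> 2 ^ (4 * b)" by (metis of_nat_le_iff of_nat_numeral of_nat_power)
  then have "log 2 (real d) \<le> log 2 (2 ^ (4 * b))" using d1 by (subst log_le_cancel_iff) simp_all
  then have lg: "log 2 (real d) \<le> 4 * real b" by (simp add: log_nat_power)
  have lg0: "0 \<le> log 2 (real d)" using d1 by simp
  have "d \<le> n div b + 3 * 2 ^ b" by (simp add: d_def)
  then have "real d \<le> real (n div b) + 3 * 2 ^ b"
    by (metis (mono_tags, lifting) of_nat_add of_nat_le_iff of_nat_mult of_nat_numeral of_nat_power)
  moreover have "real (n div b) \<le> real n / real b" by (rule of_nat_div_le_of_nat)
  ultimately have d: "real d \<le> real n / real b + 3 * 2 ^ b" by linarith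
  have "b * 2 ^ b \<le> 2 ^ b * (2 :: nat) ^ b" using less_exp[of b] by (intro mult_right_mono) simp_all
  also have "\<dots> = 4 ^ b" by (simp flip: power_mult_distrib)
  also have "\<dots> \<le> 4 * n + 4" unfolding b_def by (rule four_power_group_size)
  finally have bb: "real b * 2 ^ b \<le> 4 * real n + 4"
    by (metis (mono_tags, lifting) of_nat_add of_nat_le_iff of_nat_mult of_nat_numeral of_nat_power)
  have "real d * log 2 (real d) \<le> (real n / real b + 3 * 2 ^ b) * (4 * real b)"
    using d lg lg0 by (intro mult_mono) simp_all
  also have "\<dots> = 4 * real n + 12 * (real b * 2 ^ b)" using b(1) by (simp add: field_simps)
  also have "\<dots> \<le> 52 * (real n + 1)" using bb by simp
  finally show "real d * log 2 (real d) \<le> 52 * (real n + 1)" .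
qed

text \<open>The asymptotic estimate covers all but finitely many \<open>d\<close>, and the sum of
  the remaining absolute values absorbs these. An estimate for every \<open>d\<close> is wanted
  because the final time bound must hold for every formula.\<close>

lemma smallo_imp_affine_bound:
  fixes f g :: "nat \<Rightarrow> real"
  assumes "f \<in> o(g)" "\<epsilon> > 0"
  obtains F where "\<And>d. f d \<le> F + \<epsilon> * \<bar>g d\<bar>"
proof -
  from landau_o.smallD[OF assms] obtain d0 where d0: "\<And>d. d \<ge> d0 \<Longrightarrow> \<bar>f d\<bar> \<le> \<epsilon> * \<bar>g d\<bar>"
    by (auto simp: eventually_at_top_linorder)
  let ?F = "\<Sum>d<d0. \<bar>f d\<bar>"
  have F: "?F \<ge> 0" by (simp add: sum_nonneg)
  have "f d \<le> ?F + \<epsilon> * \<bar>g d\<bar>" for d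
  proof (cases "d < d0")
    case True
    then have "\<bar>f d\<bar> \<le> ?F" by (intro member_le_sum) simp_all
    moreover have "0 \<le> \<epsilon> * \<bar>g d\<bar>" using assms(2) by simp
    ultimately show ?thesis by linarith
  next
    case False
    with d0[of d] F show ?thesis by linarith
  qed
  then show thesis by (rule that)
qed

text \<open>The length of the encoding does not bound \<open>n\<close>, which fills a single memory
  cell, so powers of \<open>n\<close> have to be charged to the exponential factor. The source is
  \<open>(1 + y / j) ^ j \<le> exp y\<close> with \<open>y = c * ln 2 * (n + 1)\<close>.\<close>

lemma power_le_two_powr:
  assumes "c > 0"
  obtains G where "G \<ge> 0" "\<And>n. (real n + 1) ^ j \<le> G * 2 powr (c * real n)"
proof (cases "j = 0")
  case True
  then show thesis using assms by (intro that[of 1]) (simp_all add: ge_one_powr_ge_zero)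
next
  case False
  define \<delta> where "\<delta> = c * ln 2"
  have \<delta>: "\<delta> > 0" using assms by (simp add: \<delta>_def)
  have "(real n + 1) ^ j \<le> ((real j / \<delta>) ^ j * 2 powr c) * 2 powr (c * real n)" for n
  proof -
    let ?y = "\<delta> * (real n + 1)"
    have "(?y / real j) ^ j \<le> (1 + ?y / real j) ^ j" using \<delta> by (intro power_mono) simp_all
    also have "\<dots> \<le> exp ?y" using \<delta> False
      by (intro exp_ge_one_plus_x_over_n_power_n) (simp_all add: order_trans[of _ 0])
    also have "exp ?y = 2 powr c * 2 powr (c * real n)"
      by (simp add: powr_def \<delta>_def algebra_simps flip: exp_add)
    finally have *: "(?y / real j) ^ j \<le> 2 powr c * 2 powr (c * real n)" .
    have "(real n + 1) ^ j = (real j / \<delta>) ^ j * (?y / real j) ^ j"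
      using \<delta> False by (simp flip: power_mult_distrib)
    also have "\<dots> \<le> (real j / \<delta>) ^ j * (2 powr c * 2 powr (c * real n))"
      using * \<delta> by (intro mult_left_mono) simp_all
    finally show ?thesis by (simp add: mult.assoc)
  qed
  moreover have "0 \<le> (real j / \<delta>) ^ j * 2 powr c" using \<delta> by simp
  ultimately show thesis using that by blast
qed

lemma reduce_in_mav_instances:
  assumes "(n, cs) \<in> three_sat_instances"
  shows "reduce (n, cs) \<in> mav_instances"
proof -
  interpret reduction "group_size n" "n div group_size n + 1" "3 * 2 ^ group_size n" cs
    by (rule reduction_group_size[OF assms])
  have "\<forall>s\<in>set strings. length s =
      (n div group_size n + 1) * (3 * 2 ^ group_size n) + 3 * 2 ^ group_size n"
    unfolding strings_def by (auto simp del: add_mult_distrib mult_Suc)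
  then show ?thesis unfolding mav_instances_def reduce.simps Let_def by blast
qed

text \<open>The strings have length \<open>K * W + W\<close>, quadratic in \<open>n\<close>, and
  there are \<open>length cs + K\<close> of them. The constant 144 is \<open>9 * 4 ^ 2\<close>, from
  \<open>N = 4 * (n + 1)\<close>.\<close>

lemma size_reduce:
  assumes inst: "(n, cs) \<in> three_sat_instances" and red: "reduce (n, cs) = (m, ss, k, d)"
  shows "real (length ss + m + 1) \<le> 144 * (real n + 1) ^ 2 * real (length (encode_sat (n, cs)))"
proof -
  define b where "b = group_size n"
  define W where "W = 3 * (2 :: nat) ^ b"
  define K where "K = n div b + 1"
  define N where "N = 4 * n + 4"
  define L where "L = length (encode_sat (n, cs))"
  interpret reduction b K W cs
    using reduction_group_size[OF inst] by (simp add: b_def W_def K_def)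
  have "reduce (n, cs) = (K * W + W, strings, K, K + W - 2)"
    unfolding reduce.simps Let_def b_def[symmetric] W_def[symmetric] K_def[symmetric] ..
  with red have m: "m = K * W + W" "length ss = length cs + K" by (auto simp: strings_def)
  have K: "K \<le> N" by (simp add: K_def N_def le_SucI div_le_dividend order_trans[OF div_le_dividend])
  have W: "W \<le> 3 * N" using two_power_group_size[of n] by (simp add: W_def b_def N_def)
  have N: "4 \<le> N" by (simp add: N_def)
  have L: "length cs \<le> L" "1 \<le> L" using length_encode_sat(2)[OF inst] by (simp_all add: L_def)
  have "K * W \<le> N * (3 * N)" using K W by (rule mult_le_mono)
  then have "length ss + m + 1 \<le> L + (3 * (N * N) + 4 * N + 1)"
    using m K W L by simp
  also have "\<dots> \<le> L + 8 * (N * N)" using N mult_le_mono1[OF N, of N] by linarith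
  also have "\<dots> \<le> (N * N) * L + 8 * (N * N) * L"
    using L(2) N by (intro add_mono) simp_all
  also have "\<dots> = 9 * (N * N) * L" by (simp add: algebra_simps)
  finally have "length ss + m + 1 \<le> 9 * (N * N) * L" .
  then have "real (length ss + m + 1) \<le> 9 * (real N * real N) * real L"
    by (metis (mono_tags, lifting) of_nat_le_iff of_nat_mult of_nat_numeral)
  also have "\<dots> = 144 * (real n + 1) ^ 2 * real L"
    by (simp add: N_def power2_eq_square algebra_simps)
  finally show ?thesis by (simp add: L_def)
qed

section \<open>Refuting the hypothesis with a fast voting algorithm\<close>

theorem theorem3:
  assumes ETH
  shows "\<not> (\<exists>(P :: program) (f :: nat \<Rightarrow> real) (C :: real) (e :: nat).
              f \<in> o(\<lambda>d. real d * log 2 (real d)) \<and>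
              solves_in_time P mav_instances mav_yes encode_mav
                (\<lambda>(m, ss, k, d). 2 powr f d * (C * real (length ss + m + 1) ^ e)))"
proof
  assume "\<exists>(P :: program) (f :: nat \<Rightarrow> real) (C :: real) (e :: nat).
              f \<in> o(\<lambda>d. real d * log 2 (real d)) \<and>
              solves_in_time P mav_instances mav_yes encode_mav
                (\<lambda>(m, ss, k, d). 2 powr f d * (C * real (length ss + m + 1) ^ e))"
  then obtain P f C e where f: "f \<in> o(\<lambda>d. real d * log 2 (real d))"
    and P: "solves_in_time P mav_instances mav_yes encode_mav
       (\<lambda>(m, ss, k, d). 2 powr f d * (C * real (length ss + m + 1) ^ e))" by blast
  from assms obtain c where c: "c > 0"
    and no: "\<And>P C e. \<not> solves_in_time P three_sat_instances satisfiable encode_sat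
       (\<lambda>(n, cs). 2 powr (c * real n) * (C * real (length (encode_sat (n, cs))) ^ e))"
    unfolding ETH_def by blast
  \<comment> \<open>As \<open>d log d\<close> is at most \<open>52 * (n + 1)\<close>, the factor
    \<open>c / 104\<close> consumes only half of the exponent \<open>c * n\<close>. The other half
    is reserved for powers of \<open>n\<close>.\<close>
  obtain F where F: "\<And>d. f d \<le> F + c / 104 * \<bar>real d * log 2 (real d)\<bar>"
    using smallo_imp_affine_bound[OF f, of "c / 104"] c by auto
  \<comment> \<open>This exponent dominates both the 2 of the preprocessing time and the
    \<open>2 * e\<close> that comes from the quadratic instance size.\<close>
  define j where "j = 2 * e + 2"
  obtain G where G: "G \<ge> 0" "\<And>n. (real n + 1) ^ j \<le> G * 2 powr (c / 2 * real n)"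
    using power_le_two_powr[of "c / 2" j] c by auto
  define H where "H = 2 powr (F + c / 2) * (\<bar>C\<bar> * 144 ^ e)"
  \<comment> \<open>The first summand pays for the preprocessing, the second for the given program,
    doubled because each of its instructions takes two steps.\<close>
  define C' where "C' = 6000 * G + 2 * H * G"
  let ?Q = "compile 0 build_prog @ relocate (length (compile 0 build_prog)) P"
  have "solves_in_time ?Q three_sat_instances satisfiable encode_sat
       (\<lambda>(n, cs). 2 powr (c * real n) * (C' * real (length (encode_sat (n, cs))) ^ (e + 1)))"
    unfolding solves_in_time_def
  proof
    fix I assume "I \<in> three_sat_instances"
    moreover obtain n cs where I: "I = (n, cs)" by (cases I)
    ultimately have inst: "(n, cs) \<in> three_sat_instances" by simp
    define L where "L = real (length (encode_sat (n, cs)))"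
    define x where "x = real n + 1"
    define E where "E = 2 powr (c / 2 * real n)"
    obtain m ss k d where red: "reduce (n, cs) = (m, ss, k, d)" by (metis prod_cases4)
    define T' where "T' = 2 powr f d * (C * real (length ss + m + 1) ^ e)"
    have L: "real (length cs) \<le> L" "1 \<le> L"
      using length_encode_sat(2)[OF inst] by (simp_all add: L_def)
    have x: "1 \<le> x" by (simp add: x_def)
    have E: "1 \<le> E" using c by (simp add: E_def ge_one_powr_ge_zero)
    \<comment> \<open>One factor \<open>E\<close> accounts for \<open>2 powr f d\<close>, the other
      for the powers of \<open>x\<close>.\<close>
    have EE: "2 powr (c * real n) = E * E" by (simp add: E_def flip: powr_add)
    have xj: "x ^ j \<le> G * E" using G(2)[of n] by (simp add: x_def E_def)
    have H: "0 \<le> H" by (simp add: H_def)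
    have "answers_within P (encode_mav (reduce (n, cs))) T' (mav_yes (reduce (n, cs)))"
      using P reduce_in_mav_instances[OF inst] unfolding solves_in_time_def T'_def red by fastforce
    from answers_within_relocate[OF build_prog[OF inst] this]
    have ans: "answers_within ?Q (encode_sat (n, cs))
        (real (300 * (4 * n + 4) * (4 * n + 4 + length cs)) + 2 * T') (satisfiable (n, cs))"
      unfolding mav_yes_reduce[OF inst] .
    have "real (300 * (4 * n + 4) * (4 * n + 4 + length cs)) = 1200 * x * (4 * x + real (length cs))"
      by (simp add: x_def algebra_simps)
    also have "\<dots> \<le> 1200 * x * (4 * x * L + x * L)"
      using x L mult_mono[of 1 x "real (length cs)" L] by (intro mult_left_mono add_mono) simp_all
    also have "\<dots> = 6000 * x ^ 2 * L" by (simp add: power2_eq_square algebra_simps)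
    also have "\<dots> \<le> 6000 * (G * E) * L ^ (e + 1)"
    proof (intro mult_mono)
      have "x ^ 2 \<le> x ^ j" using x by (intro power_increasing) (simp_all add: j_def)
      with xj show "x ^ 2 \<le> G * E" by linarith
      show "L \<le> L ^ (e + 1)" using L by (intro self_le_power) simp_all
    qed (use G E L in simp_all)
    also have "\<dots> \<le> 6000 * (G * (E * E)) * L ^ (e + 1)"
      using G E L by (intro mult_mono) simp_all
    finally have T: "real (300 * (4 * n + 4) * (4 * n + 4 + length cs)) \<le> 6000 * (G * (E * E)) * L ^ (e + 1)" .
    have "d = n div group_size n + 1 + 3 * 2 ^ group_size n - 2" using red by (auto simp: Let_def)
    with reduced_distance_bound[of n]
    have d: "1 \<le> d" "real d * log 2 (real d) \<le> 52 * x" by (simp_all add: x_def)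
    have "f d \<le> F + c / 104 * (real d * log 2 (real d))" using F[of d] d(1) by simp
    also have "\<dots> \<le> F + c / 104 * (52 * x)" using c d(2) by (intro add_left_mono mult_left_mono) simp_all
    also have "\<dots> = (F + c / 2) + c / 2 * real n" by (simp add: x_def field_simps)
    finally have "2 powr f d \<le> 2 powr ((F + c / 2) + c / 2 * real n)" by (intro powr_mono) simp_all
    then have fd: "2 powr f d \<le> 2 powr (F + c / 2) * E" by (simp only: powr_add E_def)
    have "real (length ss + m + 1) ^ e \<le> (144 * x ^ 2 * L) ^ e"
      using size_reduce[OF inst red] by (intro power_mono) (simp_all add: x_def L_def)
    also have "\<dots> = 144 ^ e * (x ^ (2 * e) * L ^ e)" by (simp add: power_mult_distrib power_mult)
    also have "\<dots> \<le> 144 ^ e * ((G * E) * L ^ (e + 1))"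
    proof (intro mult_mono)
      have "x ^ (2 * e) \<le> x ^ j" using x by (intro power_increasing) (simp_all add: j_def)
      with xj show "x ^ (2 * e) \<le> G * E" by linarith
      show "L ^ e \<le> L ^ (e + 1)" using L by (intro power_increasing) simp_all
    qed (use G E L in simp_all)
    finally have s: "real (length ss + m + 1) ^ e \<le> 144 ^ e * ((G * E) * L ^ (e + 1))" .
    \<comment> \<open>The sign of \<open>C\<close> is unknown; passing to its absolute value makes
      the products below monotone.\<close>
    have "T' \<le> 2 powr f d * (\<bar>C\<bar> * real (length ss + m + 1) ^ e)"
      unfolding T'_def by (intro mult_left_mono mult_right_mono) simp_all
    also have "\<dots> \<le> (2 powr (F + c / 2) * E) * (\<bar>C\<bar> * (144 ^ e * ((G * E) * L ^ (e + 1))))"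
      using fd s E by (intro mult_mono mult_left_mono) simp_all
    also have "\<dots> = H * (G * (E * E)) * L ^ (e + 1)" by (simp add: H_def)
    finally have T': "T' \<le> H * (G * (E * E)) * L ^ (e + 1)" .
    have "6000 * (G * (E * E)) * L ^ (e + 1) + 2 * (H * (G * (E * E)) * L ^ (e + 1)) =
        2 powr (c * real n) * (C' * L ^ (e + 1))"
      by (simp add: EE C'_def algebra_simps)
    with T T' have "real (300 * (4 * n + 4) * (4 * n + 4 + length cs)) + 2 * T'
        \<le> 2 powr (c * real n) * (C' * L ^ (e + 1))" by linarith
    from answers_within_mono[OF ans this]
    show "answers_within ?Q (encode_sat I) (case I of (n, cs) \<Rightarrow>
        2 powr (c * real n) * (C' * real (length (encode_sat (n, cs))) ^ (e + 1))) (satisfiable I)"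
      by (simp only: I prod.case L_def)
  qed
  with no show False by blast
qed

end
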